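(* Let $G$ be an infinite graph. Then: (i) For every $X\in\mathcal X$ we have $(\mathfrak F_X,c_X)\le(\mathcal U_X,c_X)$. (ii) $\mathcal C_{\mathfrak F}\le_{\mathcal C}\mathcal C_{\mathcal U}$. (iii) $\mathfrak FG\le\vartheta G$.
   Context: $\mathcal X$: finite subsets of $V(G)$; $\mathcal C_X$: components of $G-X$ (discrete); $\phi_{X',X}$ sends a component of $G-X'$ to the component of $G-X$ containing it. $c_X(C)$ is the principal ultrafilter on $\mathcal C_X$ generated by $\{C\}$. $\mathcal U_X$ is the set of all ultrafilters on $\mathcal C_X$ with the Stone topology (basic sets $\{U:\mathcal C\in U\}$), and $f_{X',X}(U')=\{\mathcal C\subseteq\mathcal C_X:\exists\mathcal C'\in U',\mathcal C\supseteq\phi_{X',X}[\mathcal C']\}$. $\mathcal C_X(Y)$ is the set of components of $G-X$ with neighbourhood exactly $Y$, $\mathrm{crit}(X)=\{Y\subseteq X:\mathcal C_X(Y)\text{ infinite}\}$, and $\mathcal F_X(Y)$ ($Y\in\mathrm{crit}(X)$) the set of $\mathcal C\subseteq\mathcal C_X$ containing a cofinite subset of $\mathcal C_X(Y)$. $\mathfrak F_X=\{c_X(C)\}_C\cup\{\mathcal F_X(Y)\}_{Y\in\mathrm{crit}(X)}$ with topology generated by $\{\mathcal F:\mathcal C\in\mathcal F\}$; $\mathfrak f_{X',X}(c_{X'}(C'))=c_X(\phi_{X',X}(C'))$, $\mathfrak f_{X',X}(\mathcal F_{X'}(Y))=\mathcal F_X(Y)$ if $Y\subseteq X$, otherwise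 $c_X(C)$ with $C$ the component of $G-X$ including $\bigcup\mathcal C_{X'}(Y)$. $\mathcal C_{\mathcal U}=\{(\mathcal U_X,c_X),f_{X',X}\}$ and $\mathcal C_{\mathfrak F}=\{(\mathfrak F_X,c_X),\mathfrak f_{X',X}\}$. A $\mathcal C$-system is a family of Hausdorff compactifications $(\alpha(\mathcal C_X),\alpha_X)$ of the $\mathcal C_X$ with continuous compatible bonding maps $\mathfrak a_{X',X}$ satisfying $\mathfrak a_{X',X}\circ\alpha_{X'}=\alpha_X\circ\phi_{X',X}$. For compactifications, $(K,h)\le(K',h')$ means there is a continuous $f:K'\to K$ with $f\circ h'=h$. $\{(\alpha(\mathcal C_X),\alpha_X),\mathfrak a\}\le_{\mathcal C}\{(\delta(\mathcal C_X),\delta_X),\mathfrak d\}$ means that for every $X$ there is a (unique) $f_X$ witnessing $(\alpha(\mathcal C_X),\alpha_X)\le(\delta(\mathcal C_X),\delta_X)$, and $f_X\circ\mathfrak d_{X',X}=\mathfrak a_{X',X}\circ f_{X'}$ for all $X\subseteq X'$. $G$ is a 1-complex (edges copies of $[0,1]$, vertex neighbourhoods unions of half-open intervals at the vertex). $\vartheta G$ and $\mathfrak FG$ are the spaces $G\cup\varprojlim\mathcal U_X$ and $G\cup\varprojlim\mathfrak F_X$, each with the topology generated by the open sets of the 1-complex and, for $X\in\mathcal X$ and open $O$ of the $X$-th space, the sets $\bigcup\mathcal C\cup\mathring E(X,\bigcup\mathcal C)\cup\pi_X^{-1}(O)$ with $\mathcal C=c_X^{-1}(O)$ ($\pi_X$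 the projection, $\mathring E(X,\bigcup\mathcal C)$ the inner points of edges between $X$ and $\bigcup\mathcal C$). In both, each end $\omega$ is identified with $(c_X(C(X,\omega)))_X$, $C(X,\omega)$ the component of $G-X$ containing tails of the rays of $\omega$. For these spaces, $\mathfrak FG\le\vartheta G$ means there is a continuous map $\vartheta G\to\mathfrak FG$ fixing every point of $G$ and every end. *)

theory Defs
  imports "HOL-Analysis.Analysis"
begin

section \<open>Graphs, components and ends\<close>

definition simple_graph :: "'a set \<Rightarrow> 'a set set \<Rightarrow> bool" where
  "simple_graph V E \<longleftrightarrow> (\<forall>e\<in>E. \<exists>u v. u \<in> V \<and> v \<in> V \<and> u \<noteq> v \<and> e = {u, v})"

definition finsubs :: "'a set \<Rightarrow> 'a set set" where
  "finsubs V = {X. X \<subseteq> V \<and> finite X}"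

definition adj_minus :: "'a set \<Rightarrow> 'a set set \<Rightarrow> 'a set \<Rightarrow> ('a \<times> 'a) set" where
  "adj_minus V E X = {(u, v). u \<in> V - X \<and> v \<in> V - X \<and> {u, v} \<in> E}"

text \<open>Components are induced subgraphs, so they are represented by their vertex sets.\<close>

definition comps :: "'a set \<Rightarrow> 'a set set \<Rightarrow> 'a set \<Rightarrow> 'a set set" where
  "comps V E X = {(adj_minus V E X)\<^sup>* `` {v} |v. v \<in> V - X}"

definition comp_map :: "'a set \<Rightarrow> 'a set set \<Rightarrow> 'a set \<Rightarrow> 'a set \<Rightarrow> 'a set \<Rightarrow> 'a set" where
  "comp_map V E X' X C' = (THE C. C \<in> comps V E X \<and> C' \<subseteq> C)"

definition nbhd :: "'a set \<Rightarrow> 'a set set \<Rightarrow> 'a set \<Rightarrow> 'a set" where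
  "nbhd V E C = {v \<in> V - C. \<exists>u\<in>C. {u, v} \<in> E}"

definition rays :: "'a set \<Rightarrow> 'a set set \<Rightarrow> (nat \<Rightarrow> 'a) set" where
  "rays V E = {r. inj r \<and> range r \<subseteq> V \<and> (\<forall>n. {r n, r (Suc n)} \<in> E)}"

definition tail_in :: "(nat \<Rightarrow> 'a) \<Rightarrow> 'a set \<Rightarrow> bool" where
  "tail_in r C \<longleftrightarrow> (\<exists>n. \<forall>m\<ge>n. r m \<in> C)"

definition ray_equiv :: "'a set \<Rightarrow> 'a set set \<Rightarrow> ((nat \<Rightarrow> 'a) \<times> (nat \<Rightarrow> 'a)) set" where
  "ray_equiv V E = {(r, s). r \<in> rays V E \<and> s \<in> rays V E \<and>
     (\<forall>X\<in>finsubs V. \<exists>C\<in>comps V E X. tail_in r C \<and> tail_in s C)}"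

definition graph_ends :: "'a set \<Rightarrow> 'a set set \<Rightarrow> (nat \<Rightarrow> 'a) set set" where
  "graph_ends V E = rays V E // ray_equiv V E"

definition end_comp :: "'a set \<Rightarrow> 'a set set \<Rightarrow> 'a set \<Rightarrow> (nat \<Rightarrow> 'a) set \<Rightarrow> 'a set" where
  "end_comp V E X \<omega> = (THE C. C \<in> comps V E X \<and> (\<forall>r\<in>\<omega>. tail_in r C))"


section \<open>Filters on the sets of components\<close>

definition ultrafilter_on :: "'c set \<Rightarrow> 'c set set \<Rightarrow> bool" where
  "ultrafilter_on S U \<longleftrightarrow>
     U \<subseteq> Pow S \<and> S \<in> U \<and> {} \<notin> U \<and>
     (\<forall>A\<in>U. \<forall>B\<in>U. A \<inter> B \<in> U) \<and>
     (\<forall>A\<in>U. \<forall>B. A \<subseteq> B \<and> B \<subseteq> S \<longrightarrow> B \<in> U) \<and>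
     (\<forall>A. A \<subseteq> S \<longrightarrow> A \<in> U \<or> S - A \<in> U)"

definition princ :: "'a set \<Rightarrow> 'a set set \<Rightarrow> 'a set \<Rightarrow> 'a set \<Rightarrow> 'a set set set" where
  "princ V E X C = {\<C>. \<C> \<subseteq> comps V E X \<and> C \<in> \<C>}"

definition Ult :: "'a set \<Rightarrow> 'a set set \<Rightarrow> 'a set \<Rightarrow> 'a set set set set" where
  "Ult V E X = {U. ultrafilter_on (comps V E X) U}"

definition ult_bond ::
    "'a set \<Rightarrow> 'a set set \<Rightarrow> 'a set \<Rightarrow> 'a set \<Rightarrow> 'a set set set \<Rightarrow> 'a set set set" where
  "ult_bond V E X' X U' =
     {\<C>. \<C> \<subseteq> comps V E X \<and> (\<exists>\<C>'\<in>U'. comp_map V E X' X ` \<C>' \<subseteq> \<C>)}"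

definition comps_at :: "'a set \<Rightarrow> 'a set set \<Rightarrow> 'a set \<Rightarrow> 'a set \<Rightarrow> 'a set set" where
  "comps_at V E X Y = {C \<in> comps V E X. nbhd V E C = Y}"

definition crit :: "'a set \<Rightarrow> 'a set set \<Rightarrow> 'a set \<Rightarrow> 'a set set" where
  "crit V E X = {Y. Y \<subseteq> X \<and> infinite (comps_at V E X Y)}"

definition cofin_filter :: "'a set \<Rightarrow> 'a set set \<Rightarrow> 'a set \<Rightarrow> 'a set \<Rightarrow> 'a set set set" where
  "cofin_filter V E X Y = {\<C>. \<C> \<subseteq> comps V E X \<and>
     (\<exists>\<D>. \<D> \<subseteq> comps_at V E X Y \<and> finite (comps_at V E X Y - \<D>) \<and> \<D> \<subseteq> \<C>)}"

definition Frak :: "'a set \<Rightarrow> 'a set set \<Rightarrow> 'a set \<Rightarrow> 'a set set set set" where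
  "Frak V E X = princ V E X ` comps V E X \<union> cofin_filter V E X ` crit V E X"

definition frak_bond ::
    "'a set \<Rightarrow> 'a set set \<Rightarrow> 'a set \<Rightarrow> 'a set \<Rightarrow> 'a set set set \<Rightarrow> 'a set set set" where
  "frak_bond V E X' X F =
     (if F \<in> princ V E X' ` comps V E X'
      then princ V E X (comp_map V E X' X (THE C'. C' \<in> comps V E X' \<and> F = princ V E X' C'))
      else (let Y = (THE Y. Y \<in> crit V E X' \<and> F = cofin_filter V E X' Y)
            in if Y \<subseteq> X then cofin_filter V E X Y
               else princ V E X (THE C. C \<in> comps V E X \<and> \<Union> (comps_at V E X' Y) \<subseteq> C)))"

definition filter_topology :: "'c set \<Rightarrow> 'c set set set \<Rightarrow> 'c set set topology" where
  "filter_topology S \<F> = topology_generated_by {{F \<in> \<F>. A \<in> F} |A. A \<subseteq> S}"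

definition Ult_top :: "'a set \<Rightarrow> 'a set set \<Rightarrow> 'a set \<Rightarrow> 'a set set set topology" where
  "Ult_top V E X = filter_topology (comps V E X) (Ult V E X)"

definition Frak_top :: "'a set \<Rightarrow> 'a set set \<Rightarrow> 'a set \<Rightarrow> 'a set set set topology" where
  "Frak_top V E X = filter_topology (comps V E X) (Frak V E X)"


section \<open>Compactifications and \<open>\<C>\<close>-systems\<close>

definition hausdorff_compactification :: "'c topology \<Rightarrow> 'b topology \<times> ('c \<Rightarrow> 'b) \<Rightarrow> bool" where
  "hausdorff_compactification T = (\<lambda>(K, h).
     compact_space K \<and> Hausdorff_space K \<and> embedding_map T K h \<and>
     K closure_of (h ` topspace T) = topspace K)"

definition compactification_map ::
    "'c topology \<Rightarrow> 'b topology \<times> ('c \<Rightarrow> 'b) \<Rightarrow> 'd topology \<times> ('c \<Rightarrow> 'd) \<Rightarrow> ('d \<Rightarrow> 'b) \<Rightarrow> bool" where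
  "compactification_map T = (\<lambda>(K, h) (K', h') f.
     continuous_map K' K f \<and> (\<forall>x\<in>topspace T. f (h' x) = h x))"

text \<open>The two orders below relate compactifications and \<open>\<C>\<close>-systems only, so membership in
  these classes is part of the relation.\<close>

definition compactification_le ::
    "'c topology \<Rightarrow> 'b topology \<times> ('c \<Rightarrow> 'b) \<Rightarrow> 'd topology \<times> ('c \<Rightarrow> 'd) \<Rightarrow> bool" where
  "compactification_le T A D \<longleftrightarrow>
     hausdorff_compactification T A \<and> hausdorff_compactification T D \<and>
     (\<exists>f. compactification_map T A D f)"

type_synonym ('a, 'b) system =
  "('a set \<Rightarrow> 'b topology) \<times> ('a set \<Rightarrow> 'a set \<Rightarrow> 'b) \<times> ('a set \<Rightarrow> 'a set \<Rightarrow> 'b \<Rightarrow> 'b)"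

definition C_system :: "'a set \<Rightarrow> 'a set set \<Rightarrow> ('a, 'b) system \<Rightarrow> bool" where
  "C_system V E = (\<lambda>(K, h, \<aa>).
     (\<forall>X\<in>finsubs V. hausdorff_compactification (discrete_topology (comps V E X)) (K X, h X)) \<and>
     (\<forall>X\<in>finsubs V. \<forall>X'\<in>finsubs V. X \<subseteq> X' \<longrightarrow>
        continuous_map (K X') (K X) (\<aa> X' X) \<and>
        (\<forall>C'\<in>comps V E X'. \<aa> X' X (h X' C') = h X (comp_map V E X' X C'))) \<and>
     (\<forall>X\<in>finsubs V. \<forall>p\<in>topspace (K X). \<aa> X X p = p) \<and>
     (\<forall>X\<in>finsubs V. \<forall>X'\<in>finsubs V. \<forall>X''\<in>finsubs V. X \<subseteq> X' \<and> X' \<subseteq> X'' \<longrightarrow>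
        (\<forall>p\<in>topspace (K X''). \<aa> X' X (\<aa> X'' X' p) = \<aa> X'' X p)))"

text \<open>The maps \<open>f X\<close> are unique on the carriers: the image of \<open>\<C>\<^sub>X\<close> is dense and the
  target is Hausdorff.\<close>

definition C_le :: "'a set \<Rightarrow> 'a set set \<Rightarrow> ('a, 'b) system \<Rightarrow> ('a, 'd) system \<Rightarrow> bool" where
  "C_le V E = (\<lambda>(K, h, \<aa>) (K', h', \<dd>).
     C_system V E (K, h, \<aa>) \<and> C_system V E (K', h', \<dd>) \<and>
     (\<exists>f. (\<forall>X\<in>finsubs V.
             compactification_map (discrete_topology (comps V E X)) (K X, h X) (K' X, h' X) (f X)) \<and>
          (\<forall>X\<in>finsubs V. \<forall>X'\<in>finsubs V. X \<subseteq> X' \<longrightarrow>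
             (\<forall>p\<in>topspace (K' X'). f X (\<dd> X' X p) = \<aa> X' X (f X' p)))))"

definition Ult_system :: "'a set \<Rightarrow> 'a set set \<Rightarrow> ('a, 'a set set set) system" where
  "Ult_system V E = (Ult_top V E, princ V E, ult_bond V E)"

definition Frak_system :: "'a set \<Rightarrow> 'a set set \<Rightarrow> ('a, 'a set set set) system" where
  "Frak_system V E = (Frak_top V E, princ V E, frak_bond V E)"


section \<open>The 1-complex and its extensions by inverse limits\<close>

text \<open>Points of the 1-complex are given by barycentric coordinates: for an edge \<open>{u, v}\<close> the map
  \<open>edge_pt u v\<close> parametrises it by \<open>[0,1]\<close> from \<open>u\<close> to \<open>v\<close>, and
  \<open>edge_pt u v t = edge_pt v u (1 - t)\<close>.\<close>

definition vertex_pt :: "'a \<Rightarrow> 'a \<Rightarrow> real" where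
  "vertex_pt v = (\<lambda>w. if w = v then 1 else 0)"

definition edge_pt :: "'a \<Rightarrow> 'a \<Rightarrow> real \<Rightarrow> 'a \<Rightarrow> real" where
  "edge_pt u v t = (\<lambda>w. if w = u then 1 - t else if w = v then t else 0)"

definition complex_pts :: "'a set \<Rightarrow> 'a set set \<Rightarrow> ('a \<Rightarrow> real) set" where
  "complex_pts V E = vertex_pt ` V \<union> {edge_pt u v t |u v t. {u, v} \<in> E \<and> 0 < t \<and> t < 1}"

text \<open>The lengths \<open>\<epsilon> w\<close> of the half-open intervals at a vertex are chosen independently
  for each incident edge.\<close>

definition one_complex :: "'a set \<Rightarrow> 'a set set \<Rightarrow> ('a \<Rightarrow> real) topology" where
  "one_complex V E = topology_generated_by
     ({{edge_pt u v t |t. a < t \<and> t < b} |u v a b. {u, v} \<in> E \<and> 0 \<le> a \<and> a < b \<and> b \<le> 1} \<union>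
      {insert (vertex_pt v) {edge_pt v w t |w t. {v, w} \<in> E \<and> 0 \<le> t \<and> t < \<epsilon> w} |v \<epsilon>.
         v \<in> V \<and> (\<forall>w. {v, w} \<in> E \<longrightarrow> 0 < \<epsilon> w \<and> \<epsilon> w \<le> 1)})"

definition region :: "'a set \<Rightarrow> 'a set set \<Rightarrow> 'a set \<Rightarrow> 'a set set \<Rightarrow> ('a \<Rightarrow> real) set" where
  "region V E X \<C> =
     (\<Union>C\<in>\<C>. complex_pts C {e \<in> E. e \<subseteq> C}) \<union>
     {edge_pt x u t |x u t. x \<in> X \<and> u \<in> \<Union>\<C> \<and> {x, u} \<in> E \<and> 0 < t \<and> t < 1}"

definition sys_limit :: "'a set \<Rightarrow> ('a, 'b) system \<Rightarrow> ('a set \<Rightarrow> 'b) set" where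
  "sys_limit V = (\<lambda>(K, h, \<aa>).
     {x \<in> (\<Pi>\<^sub>E X\<in>finsubs V. topspace (K X)).
        \<forall>X\<in>finsubs V. \<forall>X'\<in>finsubs V. X \<subseteq> X' \<longrightarrow> \<aa> X' X (x X') = x X})"

definition extension_space ::
    "'a set \<Rightarrow> 'a set set \<Rightarrow> ('a, 'b) system \<Rightarrow> (('a \<Rightarrow> real) + ('a set \<Rightarrow> 'b)) topology" where
  "extension_space V E = (\<lambda>(K, h, \<aa>). topology_generated_by
     ({Inl ` W |W. openin (one_complex V E) W} \<union>
      {Inl ` region V E X {C \<in> comps V E X. h X C \<in> W} \<union>
       Inr ` {x \<in> sys_limit V (K, h, \<aa>). x X \<in> W} |X W. X \<in> finsubs V \<and> openin (K X) W}))"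

definition theta_space ::
    "'a set \<Rightarrow> 'a set set \<Rightarrow> (('a \<Rightarrow> real) + ('a set \<Rightarrow> 'a set set set)) topology" where
  "theta_space V E = extension_space V E (Ult_system V E)"

definition frak_space ::
    "'a set \<Rightarrow> 'a set set \<Rightarrow> (('a \<Rightarrow> real) + ('a set \<Rightarrow> 'a set set set)) topology" where
  "frak_space V E = extension_space V E (Frak_system V E)"

definition end_pt :: "'a set \<Rightarrow> 'a set set \<Rightarrow> (nat \<Rightarrow> 'a) set \<Rightarrow> 'a set \<Rightarrow> 'a set set set" where
  "end_pt V E \<omega> = (\<lambda>X\<in>finsubs V. princ V E X (end_comp V E X \<omega>))"

definition extension_le ::
    "'a set \<Rightarrow> 'a set set \<Rightarrow> (('a \<Rightarrow> real) + ('a set \<Rightarrow> 'a set set set)) topology \<Rightarrow>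
     (('a \<Rightarrow> real) + ('a set \<Rightarrow> 'a set set set)) topology \<Rightarrow> bool" where
  "extension_le V E S T \<longleftrightarrow> (\<exists>f. continuous_map T S f \<and>
     (\<forall>p\<in>complex_pts V E. f (Inl p) = Inl p) \<and>
     (\<forall>\<omega>\<in>graph_ends V E. f (Inr (end_pt V E \<omega>)) = Inr (end_pt V E \<omega>)))"

end

theory Submission
  imports Defs
begin

text \<open>
  Since \<open>X\<close> is finite, the components of \<open>G - X\<close> split into finitely many classes according to
  their neighbourhood \<open>Y \<subseteq> X\<close>, so a non-principal ultrafilter contains exactly one class, and that
  class is infinite. Sending principal ultrafilters to themselves and the others to the cofinite
  filter of their class is a continuous surjection from the Stone space of ultrafilters onto the
  Hausdorff space \<open>Frak\<close>, hence a quotient map, and it commutes with the bonding maps. Therefore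
  compactness of \<open>Frak\<close>, continuity of its bonding maps and their compatibility are all inherited
  from the ultrafilters. The maps induce a map of inverse limits, which together with the
  identity on the 1-complex is the required map of extension spaces: the preimage of a basic open
  set is a basic open set for the preimage.
\<close>

section \<open>Filters and the ultrafilter lemma\<close>

text \<open>These are the clauses of \<open>ultrafilter_on\<close> without maximality, split off
  because cofinite filters of infinite classes are not ultrafilters.\<close>

definition proper_filter_on :: "'c set \<Rightarrow> 'c set set \<Rightarrow> bool" where
  "proper_filter_on S F \<longleftrightarrow>
     F \<subseteq> Pow S \<and> S \<in> F \<and> {} \<notin> F \<and>
     (\<forall>A\<in>F. \<forall>B\<in>F. A \<inter> B \<in> F) \<and>
     (\<forall>A\<in>F. \<forall>B. A \<subseteq> B \<and> B \<subseteq> S \<longrightarrow> B \<in> F)"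

lemma ultrafilter_on_iff:
  "ultrafilter_on S U \<longleftrightarrow> proper_filter_on S U \<and> (\<forall>A. A \<subseteq> S \<longrightarrow> A \<in> U \<or> S - A \<in> U)"
  by (simp only: ultrafilter_on_def proper_filter_on_def conj_assoc)

lemma proper_filter_onD:
  assumes "proper_filter_on S F"
  shows "\<And>A. A \<in> F \<Longrightarrow> A \<subseteq> S" "S \<in> F" "{} \<notin> F"
    "\<And>A B. A \<in> F \<Longrightarrow> B \<in> F \<Longrightarrow> A \<inter> B \<in> F"
    "\<And>A B. A \<in> F \<Longrightarrow> A \<subseteq> B \<Longrightarrow> B \<subseteq> S \<Longrightarrow> B \<in> F"
proof -
  have *: "F \<subseteq> Pow S" "S \<in> F" "{} \<notin> F" "\<forall>A\<in>F. \<forall>B\<in>F. A \<inter> B \<in> F"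
    "\<forall>A\<in>F. \<forall>B. A \<subseteq> B \<and> B \<subseteq> S \<longrightarrow> B \<in> F"
    using assms unfolding proper_filter_on_def by - (elim conjE, assumption)+
  show "S \<in> F" "{} \<notin> F" by fact+
  show "A \<subseteq> S" if "A \<in> F" for A using *(1) that by blast
  show "A \<inter> B \<in> F" if "A \<in> F" "B \<in> F" for A B using *(4) that by simp
  show "B \<in> F" if "A \<in> F" "A \<subseteq> B" "B \<subseteq> S" for A B using *(5) that by simp
qed

lemma ultrafilter_on_Diff:
  assumes "ultrafilter_on S U" "A \<subseteq> S" "A \<notin> U"
  shows "S - A \<in> U"
proof -
  have "\<forall>A. A \<subseteq> S \<longrightarrow> A \<in> U \<or> S - A \<in> U" using assms(1)[unfolded ultrafilter_on_iff] by (rule conjunct2)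
  then show ?thesis using assms(2,3) by blast
qed

text \<open>Two members of the union already lie in the larger of the two filters they come from, so
  intersections can be formed there.\<close>

lemma proper_filter_on_Union_chain:
  assumes "\<CC> \<noteq> {}" and filt: "\<And>F. F \<in> \<CC> \<Longrightarrow> proper_filter_on S F"
    and chain: "\<And>F G. F \<in> \<CC> \<Longrightarrow> G \<in> \<CC> \<Longrightarrow> F \<subseteq> G \<or> G \<subseteq> F"
  shows "proper_filter_on S (\<Union>\<CC>)"
  unfolding proper_filter_on_def
proof (intro conjI ballI allI impI)
  show "\<Union>\<CC> \<subseteq> Pow S" "S \<in> \<Union>\<CC>" "{} \<notin> \<Union>\<CC>"
    using assms(1) filt unfolding proper_filter_on_def by blast+
  show "A \<inter> B \<in> \<Union>\<CC>" if AB: "A \<in> \<Union>\<CC>" "B \<in> \<Union>\<CC>" for A B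
  proof -
    obtain F G where FG: "F \<in> \<CC>" "A \<in> F" "G \<in> \<CC>" "B \<in> G" using AB by blast
    then obtain K where "K \<in> \<CC>" "A \<in> K" "B \<in> K" using chain[of F G] by blast
    then show ?thesis using proper_filter_onD(4)[OF filt[OF \<open>K \<in> \<CC>\<close>]] by blast
  qed
  show "B \<in> \<Union>\<CC>" if AB: "A \<in> \<Union>\<CC>" "A \<subseteq> B \<and> B \<subseteq> S" for A B
  proof -
    obtain F where F: "F \<in> \<CC>" "A \<in> F" using AB(1) by blast
    then show ?thesis using proper_filter_onD(5)[OF filt[OF F(1)] F(2)] AB(2) by blast
  qed
qed

text \<open>Zorn's lemma gives a maximal proper filter \<open>M\<close> above \<open>G\<close>;
  maximality decides every subset of \<open>S\<close>.\<close>

lemma ultrafilter_on_extends: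
  assumes "proper_filter_on S G"
  obtains U where "ultrafilter_on S U" "G \<subseteq> U"
proof -
  let ?A = "{F. proper_filter_on S F \<and> G \<subseteq> F}"
  have "\<exists>M\<in>?A. \<forall>F\<in>?A. M \<subseteq> F \<longrightarrow> F = M"
  proof (rule subset_Zorn_nonempty)
    show "?A \<noteq> {}" using assms by blast
    show "\<Union>\<CC> \<in> ?A" if "\<CC> \<noteq> {}" "subset.chain ?A \<CC>" for \<CC>
    proof -
      have "proper_filter_on S (\<Union>\<CC>)"
        using that by (intro proper_filter_on_Union_chain) (auto simp: subset_chain_def)
      moreover have "G \<subseteq> \<Union>\<CC>" using that unfolding subset_chain_def by blast
      ultimately show ?thesis by blast
    qed
  qed
  then obtain M where "M \<in> ?A" and maxA: "\<forall>F\<in>?A. M \<subseteq> F \<longrightarrow> F = M" ..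
  then have M: "proper_filter_on S M" "G \<subseteq> M" by simp_all
  have max: "F = M" if "proper_filter_on S F" "M \<subseteq> F" for F
    using maxA that order_trans[OF M(2) that(2)] by simp
  note Md = proper_filter_onD[OF M(1)]
  have "A \<in> M \<or> S - A \<in> M" if "A \<subseteq> S" for A
  proof (rule disjCI)
    assume nA: "S - A \<notin> M"
    \<comment> \<open>The filter generated by \<open>M\<close> and \<open>A\<close>. It is proper
      because a member of \<open>M\<close> disjoint from \<open>A\<close> would put
      \<open>S - A\<close> into \<open>M\<close>; by maximality it is \<open>M\<close>
      itself.\<close>
    let ?F = "{B. B \<subseteq> S \<and> (\<exists>C\<in>M. C \<inter> A \<subseteq> B)}"
    have "proper_filter_on S ?F"
      unfolding proper_filter_on_def
    proof (intro conjI ballI allI impI)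
      show "?F \<subseteq> Pow S" "S \<in> ?F" using Md(2) by blast+
      show "{} \<notin> ?F"
      proof
        assume "{} \<in> ?F"
        then obtain C where "C \<in> M" "C \<inter> A = {}" by blast
        then have "S - A \<in> M" using Md(1)[of C] Md(5)[of C "S - A"] by blast
        then show False using nA by simp
      qed
      show "B \<inter> D \<in> ?F" if "B \<in> ?F" "D \<in> ?F" for B D
      proof -
        obtain C where C: "C \<in> M" "C \<inter> A \<subseteq> B" using \<open>B \<in> ?F\<close> by blast
        obtain C' where C': "C' \<in> M" "C' \<inter> A \<subseteq> D" using \<open>D \<in> ?F\<close> by blast
        have "(C \<inter> C') \<inter> A \<subseteq> B \<inter> D" "B \<inter> D \<subseteq> S" using C C' that by blast+
        then show ?thesis using Md(4)[OF C(1) C'(1)] by blast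
      qed
      show "D \<in> ?F" if "B \<in> ?F" "B \<subseteq> D \<and> D \<subseteq> S" for B D using that by blast
    qed
    moreover have "M \<subseteq> ?F" using Md(1) by blast
    ultimately have "?F = M" by (rule max)
    moreover have "A \<in> ?F" using that Md(2) by blast
    ultimately show "A \<in> M" by simp
  qed
  then have "ultrafilter_on S M" using M(1) by (simp add: ultrafilter_on_iff)
  then show ?thesis using that M(2) by blast
qed

text \<open>If \<open>D\<close> is not in \<open>U\<close>, its complement is, and intersecting that
  with the whole union leaves only points of the remaining sets; induct on their number.\<close>

lemma ultrafilter_on_Union:
  assumes U: "ultrafilter_on S U" and "finite \<D>" "\<Union>\<D> \<in> U"
  shows "\<exists>D\<in>\<D>. D \<in> U"
  using assms(2,3)
proof (induction \<D> rule: finite_induct)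
  case empty
  then show ?case using U by (simp add: ultrafilter_on_def)
next
  case (insert D \<D>)
  have F: "proper_filter_on S U" and D: "\<And>A. A \<subseteq> S \<Longrightarrow> A \<in> U \<or> S - A \<in> U"
    using U by (auto simp: ultrafilter_on_iff)
  note Fd = proper_filter_onD[OF F]
  have sub: "D \<union> \<Union>\<D> \<subseteq> S" using Fd(1) insert.prems by auto
  show ?case
  proof (cases "D \<in> U")
    case False
    then have "S - D \<in> U" using D sub by blast
    then have "(S - D) \<inter> (D \<union> \<Union>\<D>) \<in> U" using Fd(4) insert.prems by auto
    then have "\<Union>\<D> \<in> U" by (rule Fd(5)) (use sub in auto)
    then show ?thesis using insert.IH by blast
  qed auto
qed

text \<open>Members of a proper filter meet each other, so each of them meets \<open>{x}\<close>;
  upward closure gives the converse.\<close>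

lemma filter_singleton_imp_principal:
  assumes F: "proper_filter_on S F" and x: "{x} \<in> F"
  shows "F = {A. A \<subseteq> S \<and> x \<in> A}"
proof (intro set_eqI iffI)
  note Fd = proper_filter_onD[OF F]
  fix A
  show "A \<in> {A. A \<subseteq> S \<and> x \<in> A}" if "A \<in> F"
  proof -
    have "A \<inter> {x} \<noteq> {}" using Fd(3) Fd(4)[OF that x] by metis
    then show ?thesis using Fd(1)[OF that] by blast
  qed
  show "A \<in> F" if "A \<in> {A. A \<subseteq> S \<and> x \<in> A}"
    using Fd(5)[OF x] that by blast
qed

lemma ultrafilter_on_principal:
  "x \<in> S \<Longrightarrow> ultrafilter_on S {A. A \<subseteq> S \<and> x \<in> A}"
  unfolding ultrafilter_on_def by blast


section \<open>Topologies on families of filters\<close>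

text \<open>The generating sets form a base and not merely a subbase: a filter contains
  \<open>A \<inter> B\<close> exactly when it contains both \<open>A\<close> and
  \<open>B\<close>.\<close>

lemma openin_filter_topology_iff:
  assumes filt: "\<And>F. F \<in> \<F> \<Longrightarrow> proper_filter_on S F"
  shows "openin (filter_topology S \<F>) W \<longleftrightarrow>
    W \<subseteq> \<F> \<and> (\<forall>F\<in>W. \<exists>A\<in>F. {G \<in> \<F>. A \<in> G} \<subseteq> W)" (is "_ \<longleftrightarrow> ?R W")
proof
  assume "openin (filter_topology S \<F>) W"
  then have "generate_topology_on {{F \<in> \<F>. A \<in> F} |A. A \<subseteq> S} W"
    by (simp add: filter_topology_def openin_topology_generated_by_iff)
  then show "?R W"
  proof induction
    case (Int a b)
    show ?case
    proof (intro conjI ballI)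
      show "a \<inter> b \<subseteq> \<F>" using Int.IH by blast
      fix F assume F: "F \<in> a \<inter> b"
      then have Fab: "F \<in> a" "F \<in> b" by simp_all
      obtain A where A: "A \<in> F" "{G \<in> \<F>. A \<in> G} \<subseteq> a"
        using bspec[OF conjunct2[OF Int.IH(1)] Fab(1)] ..
      obtain B where B: "B \<in> F" "{G \<in> \<F>. B \<in> G} \<subseteq> b"
        using bspec[OF conjunct2[OF Int.IH(2)] Fab(2)] ..
      have pF: "proper_filter_on S F" using filt[OF subsetD[OF conjunct1[OF Int.IH(1)] Fab(1)]] .
      have sub: "A \<subseteq> S" "B \<subseteq> S" using proper_filter_onD(1)[OF pF] A(1) B(1) by simp_all
      have "{G \<in> \<F>. A \<inter> B \<in> G} \<subseteq> a \<inter> b"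
      proof
        fix G assume "G \<in> {G \<in> \<F>. A \<inter> B \<in> G}"
        then have G: "G \<in> \<F>" "A \<inter> B \<in> G" by simp_all
        have "A \<in> G" "B \<in> G"
          using proper_filter_onD(5)[OF filt[OF G(1)] G(2)] sub by simp_all
        then show "G \<in> a \<inter> b" using G(1) A(2) B(2) by auto
      qed
      then show "\<exists>A\<in>F. {G \<in> \<F>. A \<in> G} \<subseteq> a \<inter> b"
        using proper_filter_onD(4)[OF pF A(1) B(1)] by (rule bexI)
    qed
  next
    case (UN K)
    show ?case
    proof (intro conjI ballI)
      show "\<Union>K \<subseteq> \<F>" using UN.IH by (simp add: Sup_le_iff)
      fix F assume "F \<in> \<Union>K"
      then obtain k where k: "k \<in> K" "F \<in> k" by (rule UnionE)
      obtain A where "A \<in> F" "{G \<in> \<F>. A \<in> G} \<subseteq> k"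
        using bspec[OF conjunct2[OF UN.IH[OF k(1)]] k(2)] ..
      then show "\<exists>A\<in>F. {G \<in> \<F>. A \<in> G} \<subseteq> \<Union>K"
        using Union_upper[OF k(1)] by (meson bexI order_trans)
    qed
  qed auto
next
  assume R: "?R W"
  show "openin (filter_topology S \<F>) W"
  proof (subst openin_subopen, intro ballI)
    fix F assume F: "F \<in> W"
    then obtain A where A: "A \<in> F" "{G \<in> \<F>. A \<in> G} \<subseteq> W" using R by meson
    have "F \<in> \<F>" using R F by (meson subsetD)
    then have "A \<subseteq> S" using proper_filter_onD(1)[OF filt A(1)] by simp
    then have "openin (filter_topology S \<F>) {G \<in> \<F>. A \<in> G}"
      unfolding filter_topology_def by (intro topology_generated_by_Basis) blast
    moreover have "F \<in> {G \<in> \<F>. A \<in> G}" using A(1) \<open>F \<in> \<F>\<close> by simp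
    ultimately show "\<exists>T. openin (filter_topology S \<F>) T \<and> F \<in> T \<and> T \<subseteq> W" using A(2) by blast
  qed
qed

lemma topspace_filter_topology:
  assumes "\<And>F. F \<in> \<F> \<Longrightarrow> proper_filter_on S F"
  shows "topspace (filter_topology S \<F>) = \<F>"
proof
  show "\<F> \<subseteq> topspace (filter_topology S \<F>)"
  proof
    fix F assume "F \<in> \<F>"
    then have "F \<in> {F \<in> \<F>. S \<in> F}" using proper_filter_onD(2)[OF assms] by simp
    then show "F \<in> topspace (filter_topology S \<F>)" unfolding filter_topology_def by auto
  qed
qed (auto simp: filter_topology_def)

lemma openin_filter_topology_basic:
  "A \<subseteq> S \<Longrightarrow> openin (filter_topology S \<F>) {F \<in> \<F>. A \<in> F}"
  unfolding filter_topology_def by (intro topology_generated_by_Basis) blast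

text \<open>No proper filter contains two disjoint sets, so disjoint members \<open>A\<close> and
  \<open>B\<close> yield disjoint basic open sets.\<close>

lemma Hausdorff_filter_topology:
  assumes filt: "\<And>F. F \<in> \<F> \<Longrightarrow> proper_filter_on S F"
    and sep: "\<And>F G. F \<in> \<F> \<Longrightarrow> G \<in> \<F> \<Longrightarrow> F \<noteq> G \<Longrightarrow> \<exists>A\<in>F. \<exists>B\<in>G. A \<inter> B = {}"
  shows "Hausdorff_space (filter_topology S \<F>)"
  unfolding Hausdorff_space_def
proof (intro allI impI)
  fix F G
  assume "F \<in> topspace (filter_topology S \<F>) \<and> G \<in> topspace (filter_topology S \<F>) \<and> F \<noteq> G"
  then have FG: "F \<in> \<F>" "G \<in> \<F>" "F \<noteq> G" by (simp_all add: topspace_filter_topology filt)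
  then obtain A B where AB: "A \<in> F" "B \<in> G" "A \<inter> B = {}" using sep[OF FG] by meson
  have sub: "A \<subseteq> S" "B \<subseteq> S"
    using proper_filter_onD(1)[OF filt[OF FG(1)] AB(1)] proper_filter_onD(1)[OF filt[OF FG(2)] AB(2)] .
  have "\<not> (A \<in> H \<and> B \<in> H)" if "H \<in> \<F>" for H
    using proper_filter_onD(3,4)[OF filt[OF that]] AB(3) by metis
  then have "disjnt {H \<in> \<F>. A \<in> H} {H \<in> \<F>. B \<in> H}"
    unfolding disjnt_iff by simp
  then show "\<exists>U V. openin (filter_topology S \<F>) U \<and> openin (filter_topology S \<F>) V \<and>
      F \<in> U \<and> G \<in> V \<and> disjnt U V"
    using openin_filter_topology_basic sub AB FG
    by (intro exI[of _ "{H \<in> \<F>. A \<in> H}"] exI[of _ "{H \<in> \<F>. B \<in> H}"]) auto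
qed

text \<open>The only filter containing \<open>{x}\<close> is \<open>p x\<close>, so the image of
  \<open>S\<close> consists of isolated points, which gives the embedding. It is dense because a
  member \<open>A\<close> of a filter is nonempty and any \<open>x\<close> in \<open>A\<close> has
  \<open>A \<in> p x\<close>. Compactness stays a hypothesis since the two systems obtain it in
  different ways.\<close>

lemma hausdorff_compactification_filter_topology:
  assumes filt: "\<And>F. F \<in> \<F> \<Longrightarrow> proper_filter_on S F"
    and sep: "\<And>F G. F \<in> \<F> \<Longrightarrow> G \<in> \<F> \<Longrightarrow> F \<noteq> G \<Longrightarrow> \<exists>A\<in>F. \<exists>B\<in>G. A \<inter> B = {}"
    and p: "\<And>x. x \<in> S \<Longrightarrow> p x = {A. A \<subseteq> S \<and> x \<in> A}"
    and pin: "\<And>x. x \<in> S \<Longrightarrow> p x \<in> \<F>"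
    and cpt: "compact_space (filter_topology S \<F>)"
  shows "hausdorff_compactification (discrete_topology S) (filter_topology S \<F>, p)"
proof -
  let ?T = "filter_topology S \<F>"
  have top: "topspace ?T = \<F>" using filt by (rule topspace_filter_topology)
  have single: "{F \<in> \<F>. {x} \<in> F} = {p x}" if "x \<in> S" for x
  proof -
    have "p x \<in> {F \<in> \<F>. {x} \<in> F}" using pin[OF that] p[OF that] that by simp
    moreover have "F = p x" if "F \<in> {F \<in> \<F>. {x} \<in> F}" for F
    proof -
      have F: "F \<in> \<F>" "{x} \<in> F" using that by simp_all
      show ?thesis
        unfolding p[OF \<open>x \<in> S\<close>] by (rule filter_singleton_imp_principal[OF filt[OF F(1)] F(2)])
    qed
    ultimately show ?thesis by (intro subset_antisym subsetI) (metis singleton_iff)+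
  qed
  have emb: "embedding_map (discrete_topology S) ?T p"
  proof (rule injective_open_imp_embedding_map)
    show "continuous_map (discrete_topology S) ?T p" using pin top by auto
    show "inj_on p (topspace (discrete_topology S))"
    proof (rule inj_onI)
      fix x y assume "x \<in> topspace (discrete_topology S)" "y \<in> topspace (discrete_topology S)"
        and eq: "p x = p y"
      then have "x \<in> S" "y \<in> S" by auto
      then have "{x} \<in> p x" using p by auto
      then have "{x} \<in> p y" using eq by simp
      then show "x = y" using p[OF \<open>y \<in> S\<close>] by auto
    qed
    show "open_map (discrete_topology S) ?T p"
      unfolding open_map_def
    proof (intro allI impI)
      fix A assume "openin (discrete_topology S) A"
      then have A: "A \<subseteq> S" by simp
      then have "p ` A = (\<Union>x\<in>A. {F \<in> \<F>. {x} \<in> F})" using single by (auto simp: subset_iff)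
      also have "openin ?T \<dots>" using A by (intro openin_Union ballI) (auto intro!: openin_filter_topology_basic)
      finally show "openin ?T (p ` A)" .
    qed
  qed
  have "?T closure_of (p ` S) = topspace ?T"
  proof (rule subset_antisym[OF closure_of_subset_topspace subsetI])
    fix F assume F: "F \<in> topspace ?T"
    show "F \<in> ?T closure_of (p ` S)"
      unfolding in_closure_of
    proof (intro conjI allI impI)
      fix W assume "F \<in> W \<and> openin ?T W"
      then have "\<exists>A\<in>F. {G \<in> \<F>. A \<in> G} \<subseteq> W" by (simp add: openin_filter_topology_iff filt)
      then obtain A where A: "A \<in> F" "{G \<in> \<F>. A \<in> G} \<subseteq> W" ..
      have pF: "proper_filter_on S F" using F top filt by simp
      have "A \<noteq> {}" "A \<subseteq> S" using proper_filter_onD(1,3)[OF pF] A(1) by auto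
      then obtain x where x: "x \<in> A" "x \<in> S" by blast
      then have "p x \<in> {G \<in> \<F>. A \<in> G}" using pin p \<open>A \<subseteq> S\<close> by simp
      then show "\<exists>y. y \<in> p ` S \<and> y \<in> W" using A(2) x(2) by (meson imageI subsetD)
    qed (use F in simp)
  qed
  moreover have "Hausdorff_space ?T" using filt sep by (rule Hausdorff_filter_topology)
  ultimately show ?thesis
    using emb cpt by (simp add: hausdorff_compactification_def)
qed

section \<open>Compactness of the space of ultrafilters\<close>

lemma compact_space_ultrafilters:
  "compact_space (filter_topology S {U. ultrafilter_on S U})"
  unfolding compact_space_alt
proof (intro allI impI, elim conjE)
  let ?U = "{U. ultrafilter_on S U}" let ?T = "filter_topology S ?U"
  have filt: "\<And>U. U \<in> ?U \<Longrightarrow> proper_filter_on S U" by (simp add: ultrafilter_on_iff)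
  have top: "topspace ?T = ?U" using filt by (rule topspace_filter_topology)
  fix \<V> assume op: "\<forall>W\<in>\<V>. openin ?T W" and cov: "topspace ?T \<subseteq> \<Union>\<V>"
  show "\<exists>\<D>. finite \<D> \<and> \<D> \<subseteq> \<V> \<and> topspace ?T \<subseteq> \<Union>\<D>"
  proof (rule ccontr)
    assume no: "\<not> ?thesis"
    txt \<open>Without a finite subcover, the sets belonging to all ultrafilters outside finitely many
      members of the cover form a proper filter; an ultrafilter extending it is not covered.\<close>
    define G where "G = {B. B \<subseteq> S \<and> (\<exists>\<D>. finite \<D> \<and> \<D> \<subseteq> \<V> \<and> (\<forall>U\<in>?U. U \<notin> \<Union>\<D> \<longrightarrow> B \<in> U))}"
    have "proper_filter_on S G"
      unfolding proper_filter_on_def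
    proof (intro conjI ballI allI impI)
      show "G \<subseteq> Pow S" by (auto simp: G_def)
      have "\<forall>U\<in>?U. U \<notin> \<Union>{} \<longrightarrow> S \<in> U" using proper_filter_onD(2)[OF filt] by simp
      moreover have "finite {}" "{} \<subseteq> \<V>" by simp_all
      ultimately show "S \<in> G" unfolding G_def by blast
      show "{} \<notin> G"
      proof
        assume "{} \<in> G"
        then obtain \<D> where "finite \<D>" "\<D> \<subseteq> \<V>" "\<forall>U\<in>?U. U \<notin> \<Union>\<D> \<longrightarrow> {} \<in> U" by (auto simp: G_def)
        \<comment> \<open>An ultrafilter outside the finite subfamily would contain the empty set,
          so the subfamily covers everything.\<close>
        moreover from this have "topspace ?T \<subseteq> \<Union>\<D>"
          unfolding top using proper_filter_onD(3)[OF filt] by (meson subsetI)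
        ultimately show False using no by blast
      qed
      show "A \<inter> B \<in> G" if AB: "A \<in> G" "B \<in> G" for A B
      proof -
        obtain \<D> \<D>' where D: "finite \<D>" "\<D> \<subseteq> \<V>" "\<forall>U\<in>?U. U \<notin> \<Union>\<D> \<longrightarrow> A \<in> U"
          and D': "finite \<D>'" "\<D>' \<subseteq> \<V>" "\<forall>U\<in>?U. U \<notin> \<Union>\<D>' \<longrightarrow> B \<in> U"
          using AB unfolding G_def by blast
        have "\<forall>U\<in>?U. U \<notin> \<Union>(\<D> \<union> \<D>') \<longrightarrow> A \<inter> B \<in> U"
          using D(3) D'(3) proper_filter_onD(4)[OF filt, of _ A B] by simp
        moreover have "finite (\<D> \<union> \<D>')" "\<D> \<union> \<D>' \<subseteq> \<V>" using D D' by blast+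
        ultimately show ?thesis using AB unfolding G_def by blast
      qed
      show "B \<in> G" if AG: "A \<in> G" and sub: "A \<subseteq> B \<and> B \<subseteq> S" for A B
      proof -
        obtain \<D> where D: "finite \<D>" "\<D> \<subseteq> \<V>" "\<forall>U\<in>?U. U \<notin> \<Union>\<D> \<longrightarrow> A \<in> U"
          using AG unfolding G_def by blast
        then have "\<forall>U\<in>?U. U \<notin> \<Union>\<D> \<longrightarrow> B \<in> U"
          using sub proper_filter_onD(5)[OF filt, of _ A B] by simp
        then show ?thesis using D(1,2) sub unfolding G_def by blast
      qed
    qed
    then obtain U where U: "ultrafilter_on S U" "G \<subseteq> U" by (rule ultrafilter_on_extends)
    have pU: "proper_filter_on S U" using U(1) by (simp add: ultrafilter_on_iff)
    have "U \<in> \<Union>\<V>" using U(1) cov unfolding top by (meson CollectI subsetD)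
    then obtain W where W: "W \<in> \<V>" "U \<in> W" by (rule UnionE)
    then have "\<exists>A\<in>U. {U' \<in> ?U. A \<in> U'} \<subseteq> W"
      using op openin_filter_topology_iff[of ?U S W, OF filt] by simp
    then obtain A where A: "A \<in> U" "{U' \<in> ?U. A \<in> U'} \<subseteq> W" ..
    have "A \<subseteq> S" using proper_filter_onD(1)[OF pU A(1)] .
    \<comment> \<open>The single set \<open>W\<close> serves as the finite subfamily: an ultrafilter
      outside \<open>W\<close> cannot contain \<open>A\<close>, hence contains \<open>S - A\<close>.
      This puts \<open>S - A\<close> into \<open>G\<close>.\<close>
    have "S - A \<in> U'" if U': "U' \<in> ?U" "U' \<notin> \<Union>{W}" for U'
    proof -
      have "A \<notin> U'" using U' A(2) by auto
      then show ?thesis using U'(1) \<open>A \<subseteq> S\<close> by (simp add: ultrafilter_on_Diff)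
    qed
    then have "\<forall>U'\<in>?U. U' \<notin> \<Union>{W} \<longrightarrow> S - A \<in> U'" by simp
    moreover have "finite {W}" "{W} \<subseteq> \<V>" using W(1) by simp_all
    ultimately have "S - A \<in> G" unfolding G_def by blast
    then have "S - A \<in> U" using U(2) by (meson subsetD)
    then have "A \<inter> (S - A) \<in> U" by (rule proper_filter_onD(4)[OF pU A(1)])
    then show False using proper_filter_onD(3)[OF pU] by simp
  qed
qed


section \<open>Components\<close>

lemma sym_adj_minus: "sym (adj_minus V E X)"
  unfolding sym_def adj_minus_def by (auto simp: insert_commute)

text \<open>Reachability is symmetric, so a component is generated by any of its vertices and not
  only by the one in its definition.\<close>

lemma compsE:
  assumes "C \<in> comps V E X" "v \<in> C"
  shows "v \<in> V - X" "C = (adj_minus V E X)\<^sup>* `` {v}"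
proof -
  obtain w where w: "w \<in> V - X" "C = (adj_minus V E X)\<^sup>* `` {w}"
    using assms(1) by (auto simp: comps_def)
  then have wv: "(w, v) \<in> (adj_minus V E X)\<^sup>*" using assms(2) by simp
  then show "v \<in> V - X" using w(1) by (induction rule: rtrancl_induct) (auto simp: adj_minus_def)
  have vw: "(v, w) \<in> (adj_minus V E X)\<^sup>*" using sym_rtrancl[OF sym_adj_minus] wv by (rule symD)
  have "(w, z) \<in> (adj_minus V E X)\<^sup>* \<longleftrightarrow> (v, z) \<in> (adj_minus V E X)\<^sup>*" for z
    using rtrancl_trans[OF wv, of z] rtrancl_trans[OF vw, of z] by (rule iffI[rotated])
  then show "C = (adj_minus V E X)\<^sup>* `` {v}" using w(2) by (simp add: Image_singleton)
qed

lemma comps_nonempty: "C \<in> comps V E X \<Longrightarrow> C \<noteq> {}"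
  by (auto simp: comps_def)

lemma comps_disjoint:
  "C \<in> comps V E X \<Longrightarrow> D \<in> comps V E X \<Longrightarrow> v \<in> C \<Longrightarrow> v \<in> D \<Longrightarrow> C = D"
  by (rule trans[OF compsE(2) compsE(2)[symmetric]])

lemma in_some_comp:
  assumes "v \<in> V - X"
  obtains C where "C \<in> comps V E X" "v \<in> C"
proof
  show "(adj_minus V E X)\<^sup>* `` {v} \<in> comps V E X" using assms unfolding comps_def by blast
  show "v \<in> (adj_minus V E X)\<^sup>* `` {v}" by simp
qed

lemma comps_adj_closed:
  assumes "C \<in> comps V E X" "u \<in> C" "v \<in> V - X" "{u, v} \<in> E"
  shows "v \<in> C"
proof -
  have "(u, v) \<in> adj_minus V E X" using assms compsE(1)[OF assms(1,2)] by (simp add: adj_minus_def)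
  then show ?thesis by (subst compsE(2)[OF assms(1,2)]) auto
qed

lemma nbhd_comp_subset: "C \<in> comps V E X \<Longrightarrow> nbhd V E C \<subseteq> X"
proof
  fix v assume C: "C \<in> comps V E X" and "v \<in> nbhd V E C"
  then obtain u where "v \<in> V - C" "u \<in> C" "{u, v} \<in> E" unfolding nbhd_def by blast
  then show "v \<in> X" using comps_adj_closed[OF C, of u v] by auto
qed

text \<open>Induction along a path from \<open>v\<close>. This is the tool for comparing components
  for different deleted sets: \<open>D\<close> will be a component of another subgraph.\<close>

lemma comps_minimal:
  assumes C: "C \<in> comps V E X" and D: "v \<in> C" "v \<in> D"
    and closed: "\<And>u w. u \<in> D \<Longrightarrow> (u, w) \<in> adj_minus V E X \<Longrightarrow> w \<in> D"
  shows "C \<subseteq> D"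
proof
  fix w assume "w \<in> C"
  then have "(v, w) \<in> (adj_minus V E X)\<^sup>*" by (subst (asm) compsE(2)[OF C D(1)]) simp
  then show "w \<in> D" using D(2) closed by (induction rule: rtrancl_induct) auto
qed

text \<open>Two components containing the nonempty set \<open>C'\<close> share a vertex and so
  coincide, which makes the definite description in \<open>comp_map\<close> meaningful.\<close>

lemma comp_map_unique:
  assumes "C' \<in> comps V E X'" "C \<in> comps V E X" "C' \<subseteq> C"
  shows "comp_map V E X' X C' = C"
  unfolding comp_map_def
proof (rule the_equality)
  show "D = C" if "D \<in> comps V E X \<and> C' \<subseteq> D" for D
  proof -
    obtain v where "v \<in> C'" using comps_nonempty[OF assms(1)] by blast
    then have "v \<in> D" "v \<in> C" using that assms(3) by auto
    then show ?thesis using that assms(2) by (intro comps_disjoint) auto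
  qed
qed (use assms in simp)

text \<open>Deleting more vertices only removes edges, so the component of \<open>G - X\<close> at a
  vertex of \<open>C'\<close> is closed under adjacency in \<open>G - X'\<close>.\<close>

lemma comp_mapE:
  assumes "X \<subseteq> X'" "C' \<in> comps V E X'"
  shows "comp_map V E X' X C' \<in> comps V E X" "C' \<subseteq> comp_map V E X' X C'"
proof -
  obtain v where v: "v \<in> C'" using comps_nonempty[OF assms(2)] by blast
  then obtain C where C: "C \<in> comps V E X" "v \<in> C"
    using in_some_comp[of v V X E] compsE(1)[OF assms(2) v] assms(1) by auto
  have "C' \<subseteq> C"
  proof (rule comps_minimal[OF assms(2) v C(2)])
    show "w \<in> C" if "u \<in> C" "(u, w) \<in> adj_minus V E X'" for u w
      using comps_adj_closed[OF C(1) that(1)] that(2) assms(1) by (auto simp: adj_minus_def)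
  qed
  then have "comp_map V E X' X C' = C" by (rule comp_map_unique[OF assms(2) C(1)])
  then show "comp_map V E X' X C' \<in> comps V E X" "C' \<subseteq> comp_map V E X' X C'"
    using C(1) \<open>C' \<subseteq> C\<close> by simp_all
qed

lemma comp_map_id: "C \<in> comps V E X \<Longrightarrow> comp_map V E X X C = C"
  by (simp add: comp_map_unique)

lemma comp_map_comp:
  assumes "X \<subseteq> X'" "X' \<subseteq> X''" "C \<in> comps V E X''"
  shows "comp_map V E X' X (comp_map V E X'' X' C) = comp_map V E X'' X C"
proof (rule comp_map_unique[OF assms(3), symmetric])
  note C' = comp_mapE[OF assms(2,3)]
  show "comp_map V E X' X (comp_map V E X'' X' C) \<in> comps V E X"
    by (rule comp_mapE(1)[OF assms(1) C'(1)])
  show "C \<subseteq> comp_map V E X' X (comp_map V E X'' X' C)"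
    using C'(2) comp_mapE(2)[OF assms(1) C'(1)] by (rule order_trans)
qed

text \<open>An edge leaving \<open>C'\<close> ends in its neighbourhood \<open>Y\<close>, which lies
  in \<open>X\<close>; hence \<open>C'\<close> cannot grow when only \<open>X\<close> is deleted and
  is already a component of \<open>G - X\<close>.\<close>

lemma comps_at_mono:
  assumes "X \<subseteq> X'" "Y \<subseteq> X"
  shows "comps_at V E X' Y \<subseteq> comps_at V E X Y"
proof
  fix C' assume "C' \<in> comps_at V E X' Y"
  then have C': "C' \<in> comps V E X'" "nbhd V E C' = Y" by (auto simp: comps_at_def)
  let ?C = "comp_map V E X' X C'"
  note C = comp_mapE[OF assms(1) C'(1)]
  obtain v where v: "v \<in> C'" using comps_nonempty[OF C'(1)] by blast
  have "?C \<subseteq> C'"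
  proof (rule comps_minimal[OF C(1) subsetD[OF C(2) v] v])
    show "w \<in> C'" if "u \<in> C'" "(u, w) \<in> adj_minus V E X" for u w
    proof (rule ccontr)
      assume "w \<notin> C'"
      then have "w \<in> nbhd V E C'" using that by (auto simp: nbhd_def adj_minus_def)
      then show False using that C'(2) assms(2) by (auto simp: adj_minus_def)
    qed
  qed
  then show "C' \<in> comps_at V E X Y" using C C' by (simp add: comps_at_def)
qed

text \<open>A vertex \<open>y\<close> of \<open>Y\<close> outside \<open>X\<close> is adjacent to
  every component of the class, so all of them merge into the component of \<open>G - X\<close>
  containing \<open>y\<close>. Nonemptiness of the class gives uniqueness.\<close>

lemma comps_at_in_one_comp:
  assumes "X \<subseteq> X'" "\<not> Y \<subseteq> X" "comps_at V E X' Y \<noteq> {}"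
  shows "\<exists>!C. C \<in> comps V E X \<and> \<Union>(comps_at V E X' Y) \<subseteq> C"
proof -
  obtain y where y: "y \<in> Y" "y \<notin> X" using assms(2) by blast
  moreover have "Y \<subseteq> V" using assms(3) by (auto simp: comps_at_def nbhd_def)
  ultimately obtain C where C: "C \<in> comps V E X" "y \<in> C" using in_some_comp[of y V X E] by auto
  have sub: "C' \<subseteq> C" if "C' \<in> comps_at V E X' Y" for C'
  proof -
    have C': "C' \<in> comps V E X'" "y \<in> nbhd V E C'" using that y by (auto simp: comps_at_def)
    then obtain u where u: "u \<in> C'" "{y, u} \<in> E" by (auto simp: nbhd_def insert_commute)
    have "u \<in> C"
      using comps_adj_closed[OF C _ u(2)] compsE(1)[OF C'(1) u(1)] assms(1) by auto
    then have "comp_map V E X' X C' = C"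
      using comp_mapE[OF assms(1) C'(1)] C(1) u(1) by (intro comps_disjoint[of _ V E X _ u]) auto
    then show ?thesis using comp_mapE(2)[OF assms(1) C'(1)] by simp
  qed
  moreover have "D = C" if D: "D \<in> comps V E X" "\<Union>(comps_at V E X' Y) \<subseteq> D" for D
  proof -
    obtain C' where C': "C' \<in> comps_at V E X' Y" using assms(3) by blast
    then have "C' \<noteq> {}" by (intro comps_nonempty[of _ V E X']) (simp add: comps_at_def)
    then obtain v where "v \<in> C'" by blast
    then have "v \<in> D" "v \<in> C" using D(2) C' sub[OF C'] by auto
    then show ?thesis by (rule comps_disjoint[OF D(1) C(1)])
  qed
  ultimately show ?thesis using C(1) by (intro ex1I[of _ C]) auto
qed

text \<open>For finite \<open>X\<close> this is a finite union, to which
  \<open>ultrafilter_on_Union\<close> applies.\<close>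

lemma Union_comps_at: "comps V E X = \<Union>(comps_at V E X ` Pow X)"
  using nbhd_comp_subset[of _ V E X] by (auto simp: comps_at_def)


section \<open>The two systems\<close>

lemma princ_in_Ult: "C \<in> comps V E X \<Longrightarrow> princ V E X C \<in> Ult V E X"
  unfolding Ult_def princ_def by (simp add: ultrafilter_on_principal)

lemma proper_filter_Ult: "U \<in> Ult V E X \<Longrightarrow> proper_filter_on (comps V E X) U"
  by (simp add: Ult_def ultrafilter_on_iff)

lemma singleton_in_Ult: "U \<in> Ult V E X \<Longrightarrow> {C} \<in> U \<Longrightarrow> U = princ V E X C"
  unfolding princ_def by (rule filter_singleton_imp_principal[OF proper_filter_Ult])

lemma princ_inj:
  assumes "C \<in> comps V E X" "princ V E X C = princ V E X D"
  shows "C = D"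
proof -
  have "{C} \<in> princ V E X D" unfolding assms(2)[symmetric] using assms(1) by (simp add: princ_def)
  then show ?thesis by (simp add: princ_def)
qed

text \<open>For a non-component \<open>C\<close> the family \<open>princ V E X C\<close> is empty,
  while an ultrafilter contains the set of all components.\<close>

lemma princ_Ult_imp_comp: "princ V E X C \<in> Ult V E X \<Longrightarrow> C \<in> comps V E X"
  by (drule proper_filter_onD(2)[OF proper_filter_Ult]) (simp add: princ_def)

section \<open>Cofinite filters of critical sets\<close>

lemma cofin_filter_iff:
  "\<A> \<in> cofin_filter V E X Y \<longleftrightarrow> \<A> \<subseteq> comps V E X \<and> finite (comps_at V E X Y - \<A>)"
proof -
  let ?P = "comps_at V E X Y"
  have "(\<exists>\<D>. \<D> \<subseteq> ?P \<and> finite (?P - \<D>) \<and> \<D> \<subseteq> \<A>) \<longleftrightarrow> finite (?P - \<A>)"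
  proof
    assume "\<exists>\<D>. \<D> \<subseteq> ?P \<and> finite (?P - \<D>) \<and> \<D> \<subseteq> \<A>"
    then obtain \<D> where D: "finite (?P - \<D>)" "\<D> \<subseteq> \<A>" by (elim exE conjE)
    show "finite (?P - \<A>)" by (rule finite_subset[OF Diff_mono[OF order_refl D(2)] D(1)])
  next
    assume "finite (?P - \<A>)"
    \<comment> \<open>The largest possible witness is the part of the class inside
      \<open>\<A>\<close>.\<close>
    then show "\<exists>\<D>. \<D> \<subseteq> ?P \<and> finite (?P - \<D>) \<and> \<D> \<subseteq> \<A>"
      by (intro exI[of _ "?P \<inter> \<A>"]) (simp add: Diff_Int)
  qed
  then show ?thesis by (simp add: cofin_filter_def)
qed

lemma comps_at_subset: "comps_at V E X Y \<subseteq> comps V E X"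
  by (auto simp: comps_at_def)

lemma comps_at_in_cofin: "comps_at V E X Y \<in> cofin_filter V E X Y"
  by (simp add: cofin_filter_iff comps_at_subset)

lemma comps_at_disjoint: "Y \<noteq> Z \<Longrightarrow> comps_at V E X Y \<inter> comps_at V E X Z = {}"
  by (auto simp: comps_at_def)

text \<open>Criticality of \<open>Y\<close> excludes the empty set: it would be cofinite in the
  class only if the class were finite.\<close>

lemma proper_filter_cofin:
  assumes "Y \<in> crit V E X"
  shows "proper_filter_on (comps V E X) (cofin_filter V E X Y)"
proof -
  let ?P = "comps_at V E X Y"
  show ?thesis
    unfolding proper_filter_on_def
  proof (intro conjI ballI allI impI)
    show "cofin_filter V E X Y \<subseteq> Pow (comps V E X)" by (simp add: subset_iff cofin_filter_iff)
    have "?P - comps V E X = {}" using comps_at_subset[of V E X Y] by simp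
    then show "comps V E X \<in> cofin_filter V E X Y" unfolding cofin_filter_iff by (simp only: finite.emptyI order_refl simp_thms)
    show "{} \<notin> cofin_filter V E X Y" using assms by (simp add: cofin_filter_iff crit_def)
    show "\<A> \<inter> \<B> \<in> cofin_filter V E X Y"
      if "\<A> \<in> cofin_filter V E X Y" "\<B> \<in> cofin_filter V E X Y" for \<A> \<B>
      using that by (simp add: cofin_filter_iff Diff_Int le_infI1)
    show "\<B> \<in> cofin_filter V E X Y"
      if "\<A> \<in> cofin_filter V E X Y" "\<A> \<subseteq> \<B> \<and> \<B> \<subseteq> comps V E X" for \<A> \<B>
      using that finite_subset[OF Diff_mono[OF order_refl, of \<A> \<B> ?P]] by (simp add: cofin_filter_iff)
  qed
qed

lemma proper_filter_Frak: "F \<in> Frak V E X \<Longrightarrow> proper_filter_on (comps V E X) F"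
  unfolding Frak_def by (elim UnE imageE) (simp_all add: proper_filter_cofin proper_filter_Ult princ_in_Ult)

text \<open>If \<open>Y\<close> and \<open>Z\<close> differ, the class of \<open>Y\<close> lies in
  the common filter but misses the whole infinite class of \<open>Z\<close>.\<close>

lemma cofin_filter_inj:
  assumes "Z \<in> crit V E X" "cofin_filter V E X Y = cofin_filter V E X Z"
  shows "Y = Z"
proof (rule ccontr)
  assume "Y \<noteq> Z"
  have "finite (comps_at V E X Z - comps_at V E X Y)"
    using comps_at_in_cofin[of V E X Y] assms(2) by (simp add: cofin_filter_iff)
  then show False
    using assms(1) comps_at_disjoint[OF \<open>Y \<noteq> Z\<close>, of V E X] by (simp add: crit_def Diff_triv Int_commute)
qed

text \<open>This set tells a cofinite filter, and every ultrafilter extending one, from the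
  principal filter at \<open>C\<close>.\<close>

lemma co_singleton_in_cofin: "comps V E X - {C} \<in> cofin_filter V E X Y"
proof -
  have "comps_at V E X Y - (comps V E X - {C}) \<subseteq> {C}" using comps_at_subset[of V E X Y] by auto
  then show ?thesis by (simp add: cofin_filter_iff finite_subset)
qed

lemma cofin_filter_not_princ: "cofin_filter V E X Y \<noteq> princ V E X C"
proof
  assume "cofin_filter V E X Y = princ V E X C"
  then have "comps V E X - {C} \<in> princ V E X C" using co_singleton_in_cofin[of V E X C Y] by simp
  then show False by (simp add: princ_def)
qed

text \<open>A set belonging to only one of the two ultrafilters has its complement in the
  other.\<close>

lemma Ult_separated:
  assumes "F \<in> Ult V E X" "G \<in> Ult V E X" "F \<noteq> G"
  shows "\<exists>A\<in>F. \<exists>B\<in>G. A \<inter> B = {}"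
proof -
  have *: "\<exists>A\<in>F. \<exists>B\<in>G. A \<inter> B = {}" if "F \<in> Ult V E X" "G \<in> Ult V E X" "A \<in> F" "A \<notin> G" for F G A
  proof -
    have "A \<subseteq> comps V E X" using proper_filter_onD(1)[OF proper_filter_Ult] that(1,3) .
    then have "comps V E X - A \<in> G" using that(2,4) by (simp add: Ult_def ultrafilter_on_Diff)
    then show ?thesis using that(3) by (intro bexI[of _ A] bexI[of _ "comps V E X - A"]) auto
  qed
  obtain A where A: "(A \<in> F) \<noteq> (A \<in> G)" using assms(3) by (meson set_eqI)
  show ?thesis
  proof (cases "A \<in> F")
    case True
    then show ?thesis using A by (intro *[OF assms(1,2) True]) simp
  next
    case False
    then have "\<exists>B\<in>G. \<exists>C\<in>F. B \<inter> C = {}" using A by (intro *[OF assms(2,1) _ False]) simp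
    then show ?thesis by (metis Int_commute)
  qed
qed

text \<open>The separating sets are two singletons, a singleton and its complement, or two classes
  of components with different neighbourhoods.\<close>

lemma Frak_separated:
  assumes "F \<in> Frak V E X" "G \<in> Frak V E X" "F \<noteq> G"
  shows "\<exists>A\<in>F. \<exists>B\<in>G. A \<inter> B = {}"
proof -
  have princ: "{C} \<in> princ V E X C" if "C \<in> comps V E X" for C using that by (simp add: princ_def)
  from assms(1,2) consider C D where "C \<in> comps V E X" "D \<in> comps V E X" "F = princ V E X C" "G = princ V E X D"
    | C Y where "C \<in> comps V E X" "F = princ V E X C" "G = cofin_filter V E X Y"
    | C Y where "C \<in> comps V E X" "G = princ V E X C" "F = cofin_filter V E X Y"
    | Y Z where "F = cofin_filter V E X Y" "G = cofin_filter V E X Z"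
    unfolding Frak_def by (elim UnE imageE) simp_all
  then show ?thesis
  proof cases
    case 1
    then have "C \<noteq> D" using assms(3) by auto
    then show ?thesis using 1(3,4) princ[OF 1(1)] princ[OF 1(2)]
      by (intro bexI[of _ "{C}"] bexI[of _ "{D}"]) simp_all
  next
    case 2
    then show ?thesis using princ[OF 2(1)] co_singleton_in_cofin[of V E X C Y]
      by (intro bexI[of _ "{C}"] bexI[of _ "comps V E X - {C}"]) simp_all
  next
    case 3
    then show ?thesis using princ[OF 3(1)] co_singleton_in_cofin[of V E X C Y]
      by (intro bexI[of _ "comps V E X - {C}"] bexI[of _ "{C}"]) simp_all
  next
    case 4
    then have "Y \<noteq> Z" using assms(3) by auto
    then show ?thesis unfolding 4 using comps_at_disjoint[of Y Z V E X] comps_at_in_cofin[of V E X]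
      by (intro bexI[of _ "comps_at V E X Y"] bexI[of _ "comps_at V E X Z"])
  qed
qed

section \<open>The compactifications by ultrafilters and their bonding maps\<close>

lemma topspace_Ult: "topspace (Ult_top V E X) = Ult V E X"
  unfolding Ult_top_def using proper_filter_Ult by (rule topspace_filter_topology)

lemma topspace_Frak: "topspace (Frak_top V E X) = Frak V E X"
  unfolding Frak_top_def using proper_filter_Frak by (rule topspace_filter_topology)

lemma openin_Ult_iff:
  "openin (Ult_top V E X) W \<longleftrightarrow>
    W \<subseteq> Ult V E X \<and> (\<forall>F\<in>W. \<exists>A\<in>F. {G \<in> Ult V E X. A \<in> G} \<subseteq> W)"
  unfolding Ult_top_def using proper_filter_Ult by (rule openin_filter_topology_iff)

lemma compactification_Ult:
  "hausdorff_compactification (discrete_topology (comps V E X)) (Ult_top V E X, princ V E X)"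
  unfolding Ult_top_def
proof (rule hausdorff_compactification_filter_topology)
  show "compact_space (filter_topology (comps V E X) (Ult V E X))"
    unfolding Ult_def by (rule compact_space_ultrafilters)
  show "princ V E X C = {\<A>. \<A> \<subseteq> comps V E X \<and> C \<in> \<A>}" for C by (rule princ_def)
qed (fact proper_filter_Ult Ult_separated princ_in_Ult)+

text \<open>The preimage of \<open>\<A>\<close> is the largest family mapped into
  \<open>\<A>\<close>, so the bonding map is the usual push-forward of ultrafilters along
  \<open>comp_map\<close>.\<close>

lemma ult_bond_iff:
  assumes "X \<subseteq> X'" "U \<in> Ult V E X'"
  shows "\<A> \<in> ult_bond V E X' X U \<longleftrightarrow>
    \<A> \<subseteq> comps V E X \<and> {C' \<in> comps V E X'. comp_map V E X' X C' \<in> \<A>} \<in> U"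
proof -
  note Ud = proper_filter_onD[OF proper_filter_Ult[OF assms(2)]]
  let ?P = "{C' \<in> comps V E X'. comp_map V E X' X C' \<in> \<A>}"
  have "?P \<in> U" if "\<C> \<in> U" "comp_map V E X' X ` \<C> \<subseteq> \<A>" for \<C>
    using Ud(1)[OF that(1)] that(2) by (intro Ud(5)[OF that(1)]) auto
  moreover have "comp_map V E X' X ` ?P \<subseteq> \<A>" by auto
  ultimately have "(\<exists>\<C>\<in>U. comp_map V E X' X ` \<C> \<subseteq> \<A>) \<longleftrightarrow> ?P \<in> U" by metis
  then show ?thesis by (simp add: ult_bond_def)
qed

text \<open>Taking preimages commutes with intersections and complements, so every ultrafilter axiom
  is carried over.\<close>

lemma ult_bond_in_Ult:
  assumes "X \<subseteq> X'" "U \<in> Ult V E X'"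
  shows "ult_bond V E X' X U \<in> Ult V E X"
proof -
  let ?S = "comps V E X" and ?S' = "comps V E X'"
  let ?pre = "\<lambda>\<A>. {C' \<in> ?S'. comp_map V E X' X C' \<in> \<A>}"
  note Ud = proper_filter_onD[OF proper_filter_Ult[OF assms(2)]]
  let ?f = "ult_bond V E X' X U"
  have iff: "A \<in> ?f \<longleftrightarrow> A \<subseteq> ?S \<and> ?pre A \<in> U" for A by (rule ult_bond_iff[OF assms])
  have pre: "?pre ?S = ?S'" "?pre {} = {}" "\<And>A B. ?pre (A \<inter> B) = ?pre A \<inter> ?pre B"
    "\<And>A. ?pre (?S - A) = ?S' - ?pre A"
    using comp_mapE(1)[OF assms(1)] by auto
  have ult: "A \<in> U \<or> ?S' - A \<in> U" if "A \<subseteq> ?S'" for A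
    using assms(2) that ultrafilter_on_Diff[of ?S' U A] by (auto simp: Ult_def)
  have "ultrafilter_on ?S ?f"
    unfolding ultrafilter_on_def
  proof (intro conjI ballI allI impI)
    show "?f \<subseteq> Pow ?S" using iff by auto
    show "?S \<in> ?f" "{} \<notin> ?f" unfolding iff pre using Ud(2,3) by simp_all
    show "A \<inter> B \<in> ?f" if "A \<in> ?f" "B \<in> ?f" for A B
      using that Ud(4)[of "?pre A" "?pre B"] unfolding iff pre(3) by auto
    show "B \<in> ?f" if "A \<in> ?f" "A \<subseteq> B \<and> B \<subseteq> ?S" for A B
    proof -
      have "?pre A \<subseteq> ?pre B" using that(2) by auto
      then show ?thesis using that Ud(5)[of "?pre A" "?pre B"] unfolding iff by auto
    qed
    show "A \<in> ?f \<or> ?S - A \<in> ?f" if "A \<subseteq> ?S" for A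
      using ult[of "?pre A"] that unfolding iff pre(4) by auto
  qed
  then show ?thesis by (simp add: Ult_def)
qed

lemma ult_bond_princ:
  assumes "X \<subseteq> X'" "C \<in> comps V E X'"
  shows "ult_bond V E X' X (princ V E X' C) = princ V E X (comp_map V E X' X C)"
proof (rule set_eqI)
  fix \<A> show "\<A> \<in> ult_bond V E X' X (princ V E X' C) \<longleftrightarrow> \<A> \<in> princ V E X (comp_map V E X' X C)"
    unfolding ult_bond_iff[OF assms(1) princ_in_Ult[OF assms(2)]] using assms(2)
    by (simp add: princ_def subset_iff)
qed

lemma ult_bond_id:
  assumes "U \<in> Ult V E X"
  shows "ult_bond V E X X U = U"
proof -
  note Ud = proper_filter_onD[OF proper_filter_Ult[OF assms]]
  have *: "{C' \<in> comps V E X. comp_map V E X X C' \<in> \<A>} = \<A>" if "\<A> \<subseteq> comps V E X" for \<A>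
    using that comp_map_id[of _ V E X] by auto
  show ?thesis
  proof (rule set_eqI)
    fix \<A> show "\<A> \<in> ult_bond V E X X U \<longleftrightarrow> \<A> \<in> U"
      unfolding ult_bond_iff[OF order_refl assms] using *[of \<A>] Ud(1)[of \<A>] by auto
  qed
qed

text \<open>Push-forward is functorial: preimages under the two component maps compose by
  \<open>comp_map_comp\<close>.\<close>

lemma ult_bond_comp:
  assumes "X \<subseteq> X'" "X' \<subseteq> X''" "U \<in> Ult V E X''"
  shows "ult_bond V E X' X (ult_bond V E X'' X' U) = ult_bond V E X'' X U"
proof -
  have *: "{C \<in> comps V E X''. comp_map V E X'' X' C \<in> {C' \<in> comps V E X'. comp_map V E X' X C' \<in> \<A>}}
      = {C \<in> comps V E X''. comp_map V E X'' X C \<in> \<A>}" for \<A>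
    using comp_map_comp[OF assms(1,2), of _ V E] comp_mapE(1)[OF assms(2), of _ V E] by auto
  have "{C' \<in> comps V E X'. comp_map V E X' X C' \<in> \<A>} \<subseteq> comps V E X'" for \<A> by auto
  then show ?thesis
    unfolding set_eq_iff ult_bond_iff[OF assms(1) ult_bond_in_Ult[OF assms(2,3)]]
      ult_bond_iff[OF assms(2,3)] ult_bond_iff[OF order_trans[OF assms(1,2)] assms(3)] * by simp
qed

text \<open>The preimage of the basic open set of \<open>A\<close> is the basic open set of the
  preimage of \<open>A\<close>.\<close>

lemma continuous_ult_bond:
  assumes "X \<subseteq> X'"
  shows "continuous_map (Ult_top V E X') (Ult_top V E X) (ult_bond V E X' X)"
  unfolding Ult_top_def[of V E X] filter_topology_def
proof (rule continuous_on_generated_topo)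
  show "ult_bond V E X' X ` topspace (Ult_top V E X')
      \<subseteq> \<Union>{{F \<in> Ult V E X. A \<in> F} |A. A \<subseteq> comps V E X}"
  proof
    fix F assume "F \<in> ult_bond V E X' X ` topspace (Ult_top V E X')"
    then have F: "F \<in> Ult V E X" using ult_bond_in_Ult[OF assms] by (auto simp: topspace_Ult)
    then have "F \<in> {F \<in> Ult V E X. comps V E X \<in> F}"
      using proper_filter_onD(2)[OF proper_filter_Ult[OF F]] by simp
    then show "F \<in> \<Union>{{F \<in> Ult V E X. A \<in> F} |A. A \<subseteq> comps V E X}" by auto
  qed
  fix W assume "W \<in> {{F \<in> Ult V E X. A \<in> F} |A. A \<subseteq> comps V E X}"
  then obtain A where A: "A \<subseteq> comps V E X" "W = {F \<in> Ult V E X. A \<in> F}" by blast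
  have "ult_bond V E X' X -` W \<inter> topspace (Ult_top V E X')
      = {U \<in> Ult V E X'. {C' \<in> comps V E X'. comp_map V E X' X C' \<in> A} \<in> U}"
    (is "_ = ?R")
  proof (rule set_eqI)
    fix U show "U \<in> ult_bond V E X' X -` W \<inter> topspace (Ult_top V E X') \<longleftrightarrow> U \<in> ?R"
    proof (cases "U \<in> Ult V E X'")
      case True
      then show ?thesis using A(1) ult_bond_in_Ult[OF assms True] ult_bond_iff[OF assms True, of A]
        by (simp add: A(2) topspace_Ult)
    qed (simp add: topspace_Ult)
  qed
  also have "openin (Ult_top V E X') \<dots>"
    unfolding Ult_top_def by (rule openin_filter_topology_basic) blast
  finally show "openin (Ult_top V E X') (ult_bond V E X' X -` W \<inter> topspace (Ult_top V E X'))" .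
qed

lemma C_system_Ult: "C_system V E (Ult_system V E)"
  by (simp add: C_system_def Ult_system_def compactification_Ult continuous_ult_bond ult_bond_princ
      topspace_Ult ult_bond_id ult_bond_comp)


section \<open>The map from ultrafilters to the quotient\<close>

text \<open>The first case is not restricted to components, so that ends are fixed without
  knowing that their components are well defined; ultrafilters are nonempty, hence never of
  the form \<open>princ V E X C\<close> for a non-component \<open>C\<close>.\<close>

definition ult_to_frak :: "'a set \<Rightarrow> 'a set set \<Rightarrow> 'a set \<Rightarrow> 'a set set set \<Rightarrow> 'a set set set" where
  "ult_to_frak V E X U =
     (if \<exists>C. U = princ V E X C then U else cofin_filter V E X (THE Y. comps_at V E X Y \<in> U))"

lemma ult_to_frak_princ [simp]: "ult_to_frak V E X (princ V E X C) = princ V E X C"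
  by (auto simp: ult_to_frak_def)

text \<open>A finite member is a finite union of singletons, one of which must then belong to
  \<open>U\<close>.\<close>

lemma Ult_finite_imp_princ:
  assumes "U \<in> Ult V E X" "finite \<A>" "\<A> \<in> U"
  shows "\<exists>C. U = princ V E X C"
proof -
  have "ultrafilter_on (comps V E X) U" using assms(1) by (simp add: Ult_def)
  then have "\<exists>D\<in>(\<lambda>C. {C}) ` \<A>. D \<in> U"
    by (rule ultrafilter_on_Union) (use assms(2,3) in simp_all)
  then obtain C where "{C} \<in> U" by (elim bexE imageE) simp
  then show ?thesis using singleton_in_Ult[OF assms(1)] by (intro exI[of _ C])
qed

lemma comps_at_Ult_unique:
  assumes "U \<in> Ult V E X" "comps_at V E X Y \<in> U" "comps_at V E X Z \<in> U"
  shows "Y = Z"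
proof (rule ccontr)
  note Ud = proper_filter_onD[OF proper_filter_Ult[OF assms(1)]]
  assume "Y \<noteq> Z"
  then show False using Ud(4)[OF assms(2,3)] Ud(3) comps_at_disjoint[of Y Z V E X] by simp
qed

lemma ult_to_frak_nonprinc:
  assumes "U \<in> Ult V E X" "\<nexists>C. U = princ V E X C" "comps_at V E X Y \<in> U"
  shows "ult_to_frak V E X U = cofin_filter V E X Y"
proof -
  have "(THE Y. comps_at V E X Y \<in> U) = Y"
    using assms(3) comps_at_Ult_unique[OF assms(1) _ assms(3)] by (rule the_equality)
  then show ?thesis using assms(2) by (simp add: ult_to_frak_def)
qed

text \<open>As \<open>X\<close> has finitely many subsets \<open>Y\<close>, some class of components
  lies in \<open>U\<close>; for non-principal \<open>U\<close> that class is infinite, so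
  \<open>Y\<close> is critical.\<close>

lemma Ult_cases:
  assumes "finite X" "U \<in> Ult V E X"
  obtains C where "C \<in> comps V E X" "U = princ V E X C"
  | Y where "Y \<in> crit V E X" "comps_at V E X Y \<in> U" "\<nexists>C. U = princ V E X C"
      "ult_to_frak V E X U = cofin_filter V E X Y"
proof (cases "\<exists>C. U = princ V E X C")
  case True
  then obtain C where "U = princ V E X C" ..
  then show ?thesis using that(1)[of C] princ_Ult_imp_comp[of V E X C] assms(2) by simp
next
  case False
  have "\<Union>(comps_at V E X ` Pow X) \<in> U"
    using proper_filter_onD(2)[OF proper_filter_Ult[OF assms(2)]] Union_comps_at[of V E X] by simp
  then have "\<exists>D\<in>comps_at V E X ` Pow X. D \<in> U"
    using assms by (intro ultrafilter_on_Union[of "comps V E X"]) (simp_all add: Ult_def)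
  then obtain Y where Y: "Y \<subseteq> X" "comps_at V E X Y \<in> U" by (elim bexE imageE) simp
  have "infinite (comps_at V E X Y)" using Ult_finite_imp_princ[OF assms(2) _ Y(2)] False by metis
  then have "Y \<in> crit V E X" using Y(1) by (simp add: crit_def)
  then show ?thesis using Y(2) False ult_to_frak_nonprinc[OF assms(2) False Y(2)] by (rule that(2))
qed

lemma ult_to_frak_in_Frak: "finite X \<Longrightarrow> U \<in> Ult V E X \<Longrightarrow> ult_to_frak V E X U \<in> Frak V E X"
  by (erule (1) Ult_cases[of X U V E]) (simp_all add: Frak_def)

lemma ult_to_frak_surj:
  assumes "finite X"
  shows "ult_to_frak V E X ` Ult V E X = Frak V E X"
proof
  show "ult_to_frak V E X ` Ult V E X \<subseteq> Frak V E X"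
    using ult_to_frak_in_Frak[OF assms] by (rule image_subsetI)
  show "Frak V E X \<subseteq> ult_to_frak V E X ` Ult V E X"
  proof
    fix F assume "F \<in> Frak V E X"
    then consider C where "C \<in> comps V E X" "F = princ V E X C"
      | Y where "Y \<in> crit V E X" "F = cofin_filter V E X Y"
      unfolding Frak_def by (elim UnE imageE) simp_all
    then show "F \<in> ult_to_frak V E X ` Ult V E X"
    proof cases
      case 1
      then have "F = ult_to_frak V E X (princ V E X C)" by simp
      then show ?thesis using princ_in_Ult[OF 1(1)] by (rule image_eqI)
    next
      case 2
      \<comment> \<open>Any ultrafilter extending the cofinite filter is a preimage: it contains the
        class of \<open>Y\<close>, and it contains the complement of every singleton, so it is not
        principal.\<close>
      obtain U where U: "ultrafilter_on (comps V E X) U" "cofin_filter V E X Y \<subseteq> U"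
        using proper_filter_cofin[OF 2(1)] by (rule ultrafilter_on_extends)
      have Ul: "U \<in> Ult V E X" using U by (simp add: Ult_def)
      have "U \<noteq> princ V E X C" for C
      proof
        assume "U = princ V E X C"
        then have "comps V E X - {C} \<in> princ V E X C"
          using subsetD[OF U(2) co_singleton_in_cofin[of V E X C Y]] by simp
        then show False by (simp add: princ_def)
      qed
      then have np: "\<nexists>C. U = princ V E X C" by simp
      have "F = ult_to_frak V E X U"
        unfolding 2(2) by (rule ult_to_frak_nonprinc[OF Ul np subsetD[OF U(2) comps_at_in_cofin], symmetric])
      then show ?thesis using Ul by (rule image_eqI)
    qed
  qed
qed

text \<open>It suffices to find, for each \<open>U\<close> whose image contains \<open>A\<close>, a
  member \<open>B\<close> of \<open>U\<close> such that the image of every ultrafilter containing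
  \<open>B\<close> contains \<open>A\<close>.\<close>

lemma continuous_ult_to_frak:
  assumes "finite X"
  shows "continuous_map (Ult_top V E X) (Frak_top V E X) (ult_to_frak V E X)"
  unfolding Frak_top_def filter_topology_def
proof (rule continuous_on_generated_topo)
  show "ult_to_frak V E X ` topspace (Ult_top V E X)
      \<subseteq> \<Union>{{F \<in> Frak V E X. A \<in> F} |A. A \<subseteq> comps V E X}"
  proof
    fix F assume "F \<in> ult_to_frak V E X ` topspace (Ult_top V E X)"
    then have F: "F \<in> Frak V E X" using ult_to_frak_in_Frak[OF assms] by (auto simp: topspace_Ult)
    then have "F \<in> {F \<in> Frak V E X. comps V E X \<in> F}"
      using proper_filter_onD(2)[OF proper_filter_Frak[OF F]] by simp
    then show "F \<in> \<Union>{{F \<in> Frak V E X. A \<in> F} |A. A \<subseteq> comps V E X}" by auto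
  qed
  fix W assume "W \<in> {{F \<in> Frak V E X. A \<in> F} |A. A \<subseteq> comps V E X}"
  then obtain A where A: "A \<subseteq> comps V E X" "W = {F \<in> Frak V E X. A \<in> F}" by blast
  let ?P = "ult_to_frak V E X -` W \<inter> topspace (Ult_top V E X)"
  have P: "U \<in> ?P \<longleftrightarrow> U \<in> Ult V E X \<and> A \<in> ult_to_frak V E X U" for U
    using ult_to_frak_in_Frak[OF assms, of U V E] unfolding A(2) topspace_Ult by auto
  show "openin (Ult_top V E X) ?P"
    unfolding openin_Ult_iff
  proof (intro conjI ballI)
    show "?P \<subseteq> Ult V E X" unfolding topspace_Ult by (rule Int_lower2)
    fix U assume "U \<in> ?P"
    then have U: "U \<in> Ult V E X" "A \<in> ult_to_frak V E X U" unfolding P by simp_all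
    note Ud = proper_filter_onD[OF proper_filter_Ult[OF U(1)]]
    from assms U(1) show "\<exists>B\<in>U. {G \<in> Ult V E X. B \<in> G} \<subseteq> ?P"
    proof (cases rule: Ult_cases)
      case (1 C)
      \<comment> \<open>A principal ultrafilter is isolated: no other ultrafilter contains
        \<open>{C}\<close>.\<close>
      then have "{C} \<in> U" by (simp add: princ_def)
      moreover have "G \<in> ?P" if "G \<in> Ult V E X" "{C} \<in> G" for G
        using singleton_in_Ult[OF that] 1(2) \<open>U \<in> ?P\<close> by simp
      ultimately show ?thesis by (intro bexI[of _ "{C}"]) auto
    next
      case (2 Y)
      have fin: "finite (comps_at V E X Y - A)" using U(2) 2(4) by (simp add: cofin_filter_iff)
      \<comment> \<open>Only finitely many components of the class lie outside \<open>A\<close>, and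
        the non-principal \<open>U\<close> has no finite member, so \<open>U\<close> contains
        \<open>?B\<close>.\<close>
      let ?B = "comps_at V E X Y \<inter> A"
      have "?B \<in> U"
      proof (rule ccontr)
        assume "?B \<notin> U"
        then have "comps V E X - ?B \<in> U"
          using U(1) A(1) by (intro ultrafilter_on_Diff) (auto simp: Ult_def)
        then have "comps_at V E X Y \<inter> (comps V E X - ?B) \<in> U" by (rule Ud(4)[OF 2(2)])
        moreover have "comps_at V E X Y \<inter> (comps V E X - ?B) = comps_at V E X Y - A"
          using comps_at_subset[of V E X Y] by auto
        ultimately have "comps_at V E X Y - A \<in> U" by simp
        then show False using Ult_finite_imp_princ[OF U(1) fin] 2(3) by simp
      qed
      moreover have "G \<in> ?P" if G: "G \<in> Ult V E X" "?B \<in> G" for G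
      proof -
        have AG: "A \<in> G" "comps_at V E X Y \<in> G"
          using proper_filter_onD(5)[OF proper_filter_Ult[OF G(1)] G(2)] A(1) comps_at_subset[of V E X Y]
          by simp_all
        \<comment> \<open>A principal \<open>G\<close> is fixed and contains \<open>A\<close>; a
          non-principal \<open>G\<close> contains the same class and is therefore sent to the same
          cofinite filter as \<open>U\<close>.\<close>
        have "A \<in> ult_to_frak V E X G"
        proof (cases "\<exists>C. G = princ V E X C")
          case True
          then show ?thesis using AG by (simp add: ult_to_frak_def)
        next
          case False
          then show ?thesis
            using ult_to_frak_nonprinc[OF G(1) False AG(2)] fin A(1) by (simp add: cofin_filter_iff)
        qed
        then show ?thesis unfolding P using G(1) by simp
      qed
      ultimately show ?thesis by (intro bexI[of _ ?B]) auto
    qed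
  qed
qed

section \<open>The quotient map and the second compactification\<close>

lemma Hausdorff_Frak: "Hausdorff_space (Frak_top V E X)"
  unfolding Frak_top_def using proper_filter_Frak Frak_separated[of _ V E X] by (rule Hausdorff_filter_topology)

lemma compact_Ult: "compact_space (Ult_top V E X)"
  unfolding Ult_top_def Ult_def by (rule compact_space_ultrafilters)

text \<open>A continuous surjection from a compact space onto a Hausdorff space is a quotient
  map.\<close>

lemma quotient_map_ult_to_frak:
  "finite X \<Longrightarrow> quotient_map (Ult_top V E X) (Frak_top V E X) (ult_to_frak V E X)"
  by (intro continuous_imp_quotient_map continuous_ult_to_frak compact_Ult Hausdorff_Frak)
     (simp_all add: topspace_Ult topspace_Frak ult_to_frak_surj)

lemma compactification_Frak:
  assumes "finite X"
  shows "hausdorff_compactification (discrete_topology (comps V E X)) (Frak_top V E X, princ V E X)"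
  unfolding Frak_top_def
proof (rule hausdorff_compactification_filter_topology)
  \<comment> \<open>Compactness passes to the image of the ultrafilter space.\<close>
  show "compact_space (filter_topology (comps V E X) (Frak V E X))"
    using image_compactin[OF compact_Ult[unfolded compact_space_def] continuous_ult_to_frak[OF assms, of V E]]
    by (simp add: compact_space_def topspace_Ult topspace_Frak[unfolded Frak_top_def]
        ult_to_frak_surj[OF assms] Frak_top_def)
  show "princ V E X C = {\<A>. \<A> \<subseteq> comps V E X \<and> C \<in> \<A>}" for C by (rule princ_def)
  show "princ V E X C \<in> Frak V E X" if "C \<in> comps V E X" for C using that by (simp add: Frak_def)
qed (fact proper_filter_Frak Frak_separated)+

section \<open>Bonding maps of the second system\<close>

lemma frak_bond_princ:
  assumes "C \<in> comps V E X'"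
  shows "frak_bond V E X' X (princ V E X' C) = princ V E X (comp_map V E X' X C)"
proof -
  have "(THE C'. C' \<in> comps V E X' \<and> princ V E X' C = princ V E X' C') = C"
    by (rule the_equality) (use assms princ_inj[OF assms] in simp, use princ_inj[OF assms] in metis)
  then show ?thesis using assms by (simp add: frak_bond_def)
qed

text \<open>A cofinite filter is never principal, so the second branch of \<open>frak_bond\<close>
  applies, and \<open>cofin_filter_inj\<close> evaluates its description of
  \<open>Y\<close>.\<close>

lemma frak_bond_cofin:
  assumes "Y \<in> crit V E X'"
  shows "frak_bond V E X' X (cofin_filter V E X' Y) =
    (if Y \<subseteq> X then cofin_filter V E X Y
     else princ V E X (THE C. C \<in> comps V E X \<and> \<Union>(comps_at V E X' Y) \<subseteq> C))"
proof -
  have "(THE Z. Z \<in> crit V E X' \<and> cofin_filter V E X' Y = cofin_filter V E X' Z) = Y"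
    by (rule the_equality) (use assms in simp, metis cofin_filter_inj)
  moreover have "cofin_filter V E X' Y \<notin> princ V E X' ` comps V E X'"
    using cofin_filter_not_princ[of V E X' Y] by (auto simp del: not_ex)
  ultimately show ?thesis by (simp add: frak_bond_def Let_def)
qed

text \<open>For principal \<open>U\<close> both sides follow \<open>comp_map\<close>. Otherwise let
  \<open>Y\<close> be the critical set whose class lies in \<open>U\<close>; the two branches of
  \<open>frak_bond\<close> describe what the push-forward does with that class.\<close>

lemma ult_to_frak_bond:
  assumes "X \<subseteq> X'" "finite X'" "U \<in> Ult V E X'"
  shows "ult_to_frak V E X (ult_bond V E X' X U) = frak_bond V E X' X (ult_to_frak V E X' U)"
  using assms(2,3)
proof (cases rule: Ult_cases)
  case (1 C)
  then show ?thesis using assms by (simp add: ult_bond_princ frak_bond_princ)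
next
  case (2 Y)
  let ?P = "comps_at V E X' Y" let ?f = "ult_bond V E X' X U"
  note Ud = proper_filter_onD[OF proper_filter_Ult[OF assms(3)]]
  note iff = ult_bond_iff[OF assms(1,3)]
  have f: "?f \<in> Ult V E X" by (rule ult_bond_in_Ult[OF assms(1,3)])
  show ?thesis
  proof (cases "Y \<subseteq> X")
    case True
    \<comment> \<open>The components of the class survive unchanged in \<open>G - X\<close>, so
      \<open>comp_map\<close> fixes them and the push-forward contains the class of \<open>Y\<close>
      over \<open>X\<close>.\<close>
    have PX: "?P \<subseteq> comps_at V E X Y" by (rule comps_at_mono[OF assms(1) True])
    then have id: "comp_map V E X' X C = C" if "C \<in> ?P" for C
      using that by (intro comp_map_unique) (auto simp: comps_at_def)
    have "{C' \<in> comps V E X'. comp_map V E X' X C' \<in> comps_at V E X Y} \<in> U"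
      using 2(2) by (rule Ud(5)) (use PX id comps_at_subset[of V E X' Y] in auto)
    then have at: "comps_at V E X Y \<in> ?f" unfolding iff by (simp add: comps_at_subset)
    \<comment> \<open>Were the push-forward principal at \<open>C\<close>, the fibre over
      \<open>C\<close> would lie in \<open>U\<close> and meet the class in at most \<open>C\<close>,
      giving \<open>U\<close> a finite member.\<close>
    have "?f \<noteq> princ V E X C" for C
    proof
      assume eq: "?f = princ V E X C"
      then have "C \<in> comps V E X" using f by (intro princ_Ult_imp_comp) simp
      then have "{C} \<in> ?f" unfolding eq by (simp add: princ_def)
      then have "{C' \<in> comps V E X'. comp_map V E X' X C' \<in> {C}} \<in> U" unfolding iff by (rule conjunct2)
      then have "?P \<inter> {C' \<in> comps V E X'. comp_map V E X' X C' \<in> {C}} \<in> U" by (rule Ud(4)[OF 2(2)])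
      moreover have "?P \<inter> {C' \<in> comps V E X'. comp_map V E X' X C' \<in> {C}} \<subseteq> {C}" using id by auto
      then have "finite (?P \<inter> {C' \<in> comps V E X'. comp_map V E X' X C' \<in> {C}})"
        by (rule finite_subset) simp
      ultimately show False using Ult_finite_imp_princ[OF assms(3)] 2(3) by metis
    qed
    then have "ult_to_frak V E X ?f = cofin_filter V E X Y"
      by (intro ult_to_frak_nonprinc[OF f _ at]) simp
    then show ?thesis using True 2 by (simp add: frak_bond_cofin)
  next
    case False
    have "?P \<noteq> {}" using 2(1) by (auto simp: crit_def)
    \<comment> \<open>Here the whole class merges into the single component \<open>?C\<close>, so
      the push-forward contains \<open>{?C}\<close> and is principal.\<close>
    let ?C = "THE C. C \<in> comps V E X \<and> \<Union>?P \<subseteq> C"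
    have C: "?C \<in> comps V E X" "\<Union>?P \<subseteq> ?C"
      using theI'[OF comps_at_in_one_comp[OF assms(1) False \<open>?P \<noteq> {}\<close>]] by simp_all
    have "comp_map V E X' X C' = ?C" if "C' \<in> ?P" for C'
      using that by (intro comp_map_unique[OF _ C(1) order_trans[OF Union_upper C(2)]])
        (simp_all add: comps_at_def)
    then have "{C' \<in> comps V E X'. comp_map V E X' X C' \<in> {?C}} \<in> U"
      using comps_at_subset[of V E X' Y] by (intro Ud(5)[OF 2(2)]) (simp_all add: subset_iff)
    then have "{?C} \<in> ?f" unfolding iff using C(1) by simp
    then have "?f = princ V E X ?C" by (rule singleton_in_Ult[OF f])
    then show ?thesis using False 2 by (simp add: frak_bond_cofin)
  qed
qed

text \<open>Continuity may be tested after composing with the quotient map, where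
  \<open>ult_to_frak_bond\<close> rewrites the composite as a composite of continuous maps.\<close>

lemma continuous_frak_bond:
  assumes "X \<subseteq> X'" "finite X'"
  shows "continuous_map (Frak_top V E X') (Frak_top V E X) (frak_bond V E X' X)"
proof (rule continuous_compose_quotient_map[OF quotient_map_ult_to_frak[OF assms(2)]])
  have "continuous_map (Ult_top V E X') (Frak_top V E X) (ult_to_frak V E X \<circ> ult_bond V E X' X)"
    by (rule continuous_map_compose[OF continuous_ult_bond[OF assms(1)]
          continuous_ult_to_frak[OF finite_subset[OF assms]]])
  then show "continuous_map (Ult_top V E X') (Frak_top V E X) (frak_bond V E X' X \<circ> ult_to_frak V E X')"
    by (rule continuous_map_eq) (simp add: topspace_Ult ult_to_frak_bond assms)
qed

lemma frak_bond_id: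
  assumes "finite X" "F \<in> Frak V E X"
  shows "frak_bond V E X X F = F"
proof -
  obtain U where "U \<in> Ult V E X" "F = ult_to_frak V E X U"
    using assms(2) unfolding ult_to_frak_surj[OF assms(1), symmetric] by (elim imageE) simp
  then show ?thesis using ult_to_frak_bond[OF order_refl assms(1), of U V E] ult_bond_id[of U V E X] by simp
qed

text \<open>Each \<open>F\<close> is the image of an ultrafilter, and
  \<open>ult_to_frak_bond\<close> carries the law over from \<open>ult_bond_comp\<close>.\<close>

lemma frak_bond_comp:
  assumes "X \<subseteq> X'" "X' \<subseteq> X''" "finite X''" "F \<in> Frak V E X''"
  shows "frak_bond V E X' X (frak_bond V E X'' X' F) = frak_bond V E X'' X F"
proof -
  obtain U where U: "U \<in> Ult V E X''" "F = ult_to_frak V E X'' U"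
    using assms(4) unfolding ult_to_frak_surj[OF assms(3), symmetric] by (elim imageE) simp
  have fin: "finite X'" using assms(2,3) by (rule finite_subset)
  show ?thesis
    unfolding U(2) ult_to_frak_bond[OF assms(2,3) U(1), symmetric]
      ult_to_frak_bond[OF assms(1) fin ult_bond_in_Ult[OF assms(2) U(1)], symmetric]
      ult_to_frak_bond[OF order_trans[OF assms(1,2)] assms(3) U(1), symmetric]
      ult_bond_comp[OF assms(1,2) U(1)] ..
qed

lemma C_system_Frak: "C_system V E (Frak_system V E)"
  by (simp add: C_system_def Frak_system_def compactification_Frak continuous_frak_bond frak_bond_princ
      topspace_Frak frak_bond_id frak_bond_comp finsubs_def)

lemma compactification_map_ult_to_frak:
  "finite X \<Longrightarrow> compactification_map (discrete_topology (comps V E X))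
     (Frak_top V E X, princ V E X) (Ult_top V E X, princ V E X) (ult_to_frak V E X)"
  by (simp add: compactification_map_def continuous_ult_to_frak)

lemma C_le_Frak_Ult: "C_le V E (Frak_system V E) (Ult_system V E)"
proof -
  have "\<exists>f. (\<forall>X\<in>finsubs V. compactification_map (discrete_topology (comps V E X))
         (Frak_top V E X, princ V E X) (Ult_top V E X, princ V E X) (f X)) \<and>
      (\<forall>X\<in>finsubs V. \<forall>X'\<in>finsubs V. X \<subseteq> X' \<longrightarrow>
         (\<forall>p\<in>topspace (Ult_top V E X'). f X (ult_bond V E X' X p) = frak_bond V E X' X (f X' p)))"
    by (intro exI[of _ "ult_to_frak V E"])
       (simp add: compactification_map_ult_to_frak ult_to_frak_bond topspace_Ult finsubs_def)
  then show ?thesis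
    using C_system_Frak[of V E] C_system_Ult[of V E] by (simp add: C_le_def Frak_system_def Ult_system_def)
qed


section \<open>The induced map of extension spaces\<close>

text \<open>The restriction to \<open>finsubs V\<close> places the values in the extensional product
  underlying \<open>sys_limit\<close>.\<close>

definition limit_map :: "'a set \<Rightarrow> 'a set set \<Rightarrow> ('a set \<Rightarrow> 'a set set set) \<Rightarrow> 'a set \<Rightarrow> 'a set set set" where
  "limit_map V E x = (\<lambda>X\<in>finsubs V. ult_to_frak V E X (x X))"

text \<open>Compatibility of the new coordinates is \<open>ult_to_frak_bond\<close> applied to a
  compatible family.\<close>

lemma limit_map_in_limit:
  assumes "x \<in> sys_limit V (Ult_system V E)"
  shows "limit_map V E x \<in> sys_limit V (Frak_system V E)"
proof -
  have x: "x X \<in> Ult V E X" if "X \<in> finsubs V" for X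
    using assms that by (auto simp: sys_limit_def Ult_system_def topspace_Ult)
  have b: "ult_bond V E X' X (x X') = x X" if "X \<in> finsubs V" "X' \<in> finsubs V" "X \<subseteq> X'" for X X'
    using assms that by (auto simp: sys_limit_def Ult_system_def)
  have "frak_bond V E X' X (ult_to_frak V E X' (x X')) = ult_to_frak V E X (x X)"
    if "X \<in> finsubs V" "X' \<in> finsubs V" "X \<subseteq> X'" for X X'
    using that ult_to_frak_bond[OF that(3) _ x[OF that(2)]] b[OF that] by (simp add: finsubs_def)
  moreover have "ult_to_frak V E X (x X) \<in> Frak V E X" if "X \<in> finsubs V" for X
    using ult_to_frak_in_Frak[OF _ x[OF that]] that by (simp add: finsubs_def)
  ultimately show ?thesis
    by (auto simp: sys_limit_def Frak_system_def limit_map_def topspace_Frak)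
qed

lemma limit_map_end_pt: "limit_map V E (end_pt V E \<omega>) = end_pt V E \<omega>"
  unfolding limit_map_def end_pt_def by (rule restrict_ext) simp

definition basic_nbhd ::
    "'a set \<Rightarrow> 'a set set \<Rightarrow> ('a, 'b) system \<Rightarrow> 'a set \<Rightarrow> 'b set \<Rightarrow> (('a \<Rightarrow> real) + ('a set \<Rightarrow> 'b)) set" where
  "basic_nbhd V E = (\<lambda>(K, h, \<aa>) X W. Inl ` region V E X {C \<in> comps V E X. h X C \<in> W} \<union>
       Inr ` {x \<in> sys_limit V (K, h, \<aa>). x X \<in> W})"

lemma extension_space_eq:
  "extension_space V E (K, h, \<aa>) = topology_generated_by
     ({Inl ` W |W. openin (one_complex V E) W} \<union>
      {basic_nbhd V E (K, h, \<aa>) X W |X W. X \<in> finsubs V \<and> openin (K X) W})"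
  by (simp add: extension_space_def basic_nbhd_def)

lemma theta_space_eq:
  "theta_space V E = topology_generated_by
     ({Inl ` W |W. openin (one_complex V E) W} \<union>
      {basic_nbhd V E (Ult_system V E) X W |X W. X \<in> finsubs V \<and> openin (Ult_top V E X) W})"
  by (simp add: theta_space_def Ult_system_def extension_space_eq)

lemma frak_space_eq:
  "frak_space V E = topology_generated_by
     ({Inl ` W |W. openin (one_complex V E) W} \<union>
      {basic_nbhd V E (Frak_system V E) X W |X W. X \<in> finsubs V \<and> openin (Frak_top V E X) W})"
  by (simp add: frak_space_def Frak_system_def extension_space_eq)

lemma Inr_topspace_theta: "Inr x \<in> topspace (theta_space V E) \<Longrightarrow> x \<in> sys_limit V (Ult_system V E)"
  by (auto simp: theta_space_eq basic_nbhd_def Ult_system_def)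

lemma region_mono: "\<C> \<subseteq> \<D> \<Longrightarrow> region V E X \<C> \<subseteq> region V E X \<D>"
  unfolding region_def by (intro Un_mono UN_mono) blast+

text \<open>As \<open>ult_to_frak\<close> fixes principal ultrafilters, \<open>W\<close> and its
  preimage select the same components, so the parts in the 1-complex agree. The limit parts agree
  coordinatewise at \<open>X\<close>; cutting down to the space keeps only points of the
  limit.\<close>

lemma vimage_basic_nbhd:
  assumes X: "X \<in> finsubs V"
  shows "map_sum id (limit_map V E) -` basic_nbhd V E (Frak_system V E) X W \<inter> topspace (theta_space V E)
    = basic_nbhd V E (Ult_system V E) X (ult_to_frak V E X -` W \<inter> topspace (Ult_top V E X))
      \<inter> topspace (theta_space V E)" (is "?L = ?R")
proof (rule set_eqI)
  have comps: "{C \<in> comps V E X. princ V E X C \<in> ult_to_frak V E X -` W \<inter> topspace (Ult_top V E X)}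
      = {C \<in> comps V E X. princ V E X C \<in> W}"
    by (auto simp: princ_in_Ult topspace_Ult)
  fix z show "z \<in> ?L \<longleftrightarrow> z \<in> ?R"
  proof (cases z)
    case (Inl p)
    then show ?thesis by (auto simp: basic_nbhd_def Frak_system_def Ult_system_def comps[simplified])
  next
    case (Inr x)
    show ?thesis
    proof (cases "Inr x \<in> topspace (theta_space V E)")
      case True
      then have x: "x \<in> sys_limit V (Ult_system V E)" by (rule Inr_topspace_theta)
      then have "x X \<in> Ult V E X" using X by (auto simp: sys_limit_def Ult_system_def topspace_Ult)
      moreover have "limit_map V E x X = ult_to_frak V E X (x X)" using X by (simp add: limit_map_def)
      ultimately show ?thesis
        using Inr True x limit_map_in_limit[OF x]
        by (auto simp: basic_nbhd_def Frak_system_def Ult_system_def topspace_Ult)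
    qed (use Inr in simp)
  qed
qed

lemma continuous_extension_map:
  "continuous_map (theta_space V E) (frak_space V E) (map_sum id (limit_map V E))"
  unfolding frak_space_eq
proof (rule continuous_on_generated_topo)
  let ?f = "map_sum id (limit_map V E)" let ?T = "theta_space V E"
  let ?G = "{Inl ` W |W. openin (one_complex V E) W} \<union>
      {basic_nbhd V E (Frak_system V E) X W |X W. X \<in> finsubs V \<and> openin (Frak_top V E X) W}"
  have basic: "openin ?T (basic_nbhd V E (Ult_system V E) X W)"
    if "X \<in> finsubs V" "openin (Ult_top V E X) W" for X W
    unfolding theta_space_eq using that by (intro topology_generated_by_Basis) blast
  fix S assume "S \<in> ?G"
  then consider W where "openin (one_complex V E) W" "S = Inl ` W"
    | X W where "X \<in> finsubs V" "openin (Frak_top V E X) W" "S = basic_nbhd V E (Frak_system V E) X W"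
    by blast
  then show "openin ?T (?f -` S \<inter> topspace ?T)"
  proof cases
    case 1
    \<comment> \<open>The map is the identity on the 1-complex and never sends a limit point into
      it.\<close>
    have "z \<in> ?f -` Inl ` W \<longleftrightarrow> z \<in> Inl ` W" for z by (cases z) auto
    then have "?f -` Inl ` W = Inl ` W" by (rule set_eqI)
    moreover have "openin ?T (Inl ` W)"
      unfolding theta_space_eq using 1 by (intro topology_generated_by_Basis) blast
    ultimately show ?thesis using 1 by (simp add: openin_Int)
  next
    case 2
    have "openin (Ult_top V E X) (ult_to_frak V E X -` W \<inter> topspace (Ult_top V E X))"
      using continuous_ult_to_frak[of X V E] 2 by (auto simp: continuous_map_alt finsubs_def)
    then show ?thesis unfolding 2(3) vimage_basic_nbhd[OF 2(1)]
      using basic 2(1) by blast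
  qed
next
  let ?f = "map_sum id (limit_map V E)" let ?T = "theta_space V E"
  let ?G = "{Inl ` W |W. openin (one_complex V E) W} \<union>
      {basic_nbhd V E (Frak_system V E) X W |X W. X \<in> finsubs V \<and> openin (Frak_top V E X) W}"
  show "?f ` topspace ?T \<subseteq> \<Union>?G"
  proof clarify
    fix z assume "z \<in> topspace ?T"
    then consider W where "openin (one_complex V E) W" "z \<in> Inl ` W"
      | X W where "X \<in> finsubs V" "openin (Ult_top V E X) W" "z \<in> basic_nbhd V E (Ult_system V E) X W"
      unfolding theta_space_eq topology_generated_by_topspace by blast
    then show "?f z \<in> \<Union>?G"
    proof cases
      case 1
      then have "?f z \<in> Inl ` W" by auto
      then show ?thesis using 1(1) by blast
    next
      case 2
      \<comment> \<open>To see that the image lies in some generator, the whole space at the same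
        \<open>X\<close> is used in place of \<open>W\<close>: the region only grows, and the
        coordinate condition is automatic.\<close>
      have "openin (Frak_top V E X) (topspace (Frak_top V E X))" by simp
      moreover have "?f z \<in> basic_nbhd V E (Frak_system V E) X (topspace (Frak_top V E X))"
      proof (cases z)
        case (Inl p)
        show ?thesis
        proof -
          have "{C \<in> comps V E X. princ V E X C \<in> W}
              \<subseteq> {C \<in> comps V E X. princ V E X C \<in> topspace (Frak_top V E X)}"
            by (auto simp: topspace_Frak Frak_def)
          moreover have "p \<in> region V E X {C \<in> comps V E X. princ V E X C \<in> W}"
            using 2(3) Inl by (auto simp: basic_nbhd_def Ult_system_def)
          ultimately have "p \<in> region V E X {C \<in> comps V E X. princ V E X C \<in> topspace (Frak_top V E X)}"
            by (rule subsetD[OF region_mono])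
          then show ?thesis using Inl by (simp add: basic_nbhd_def Frak_system_def)
        qed
      next
        case (Inr x)
        then have "x \<in> sys_limit V (Ult_system V E)"
          using 2(3) by (auto simp: basic_nbhd_def Ult_system_def)
        then have "limit_map V E x \<in> sys_limit V (Frak_system V E)" by (rule limit_map_in_limit)
        then show ?thesis
          using Inr 2(1) by (auto simp: basic_nbhd_def Frak_system_def sys_limit_def)
      qed
      ultimately show ?thesis using 2(1) by blast
    qed
  qed
qed

theorem theorem5p4p7:
  fixes V :: "'a set" and E :: "'a set set"
  assumes "simple_graph V E" and "infinite V"
  shows "(\<forall>X\<in>finsubs V. compactification_le (discrete_topology (comps V E X))
            (Frak_top V E X, princ V E X) (Ult_top V E X, princ V E X)) \<and>
         C_le V E (Frak_system V E) (Ult_system V E) \<and>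
         extension_le V E (frak_space V E) (theta_space V E)"
proof (intro conjI ballI)
  show "compactification_le (discrete_topology (comps V E X))
      (Frak_top V E X, princ V E X) (Ult_top V E X, princ V E X)" if "X \<in> finsubs V" for X
  proof -
    have "finite X" using that by (simp add: finsubs_def)
    then show ?thesis
      unfolding compactification_le_def
      by (intro conjI compactification_Frak compactification_Ult exI[of _ "ult_to_frak V E X"]
          compactification_map_ult_to_frak)
  qed
  show "C_le V E (Frak_system V E) (Ult_system V E)" by (rule C_le_Frak_Ult)
  show "extension_le V E (frak_space V E) (theta_space V E)"
    unfolding extension_le_def using continuous_extension_map[of V E]
    by (intro exI[of _ "map_sum id (limit_map V E)"]) (simp add: limit_map_end_pt)
qed

end
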